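(* Let $H \in \mathbb{C}^{N\times N}$ be a complex matrix and let $S_h \in \mathbb{C}^{N\times N}$ be a family of complex matrices depending smoothly on $h\in \mathbb{R}$ such that (i) the spectrum of $S_h$ satisfies $\sigma(S_h) = \overline{\sigma(S_h)}$; (ii) $S_h$ is consistent with $\exp(hH)$, i.e. there exists $p\geq 1$ such that $S_h = e^{hH} + \mathcal{O}(h^{p+1})$ as $h\to 0$; (iii) the eigenvalues of $H$ are real and simple. Then there exist a family $D_h$ of real diagonal matrices depending smoothly on $h$ and a family $P_h$ of complex invertible matrices depending smoothly on $h$ such that $P_h = P_0 + \mathcal{O}(h^p)$, $D_h = D_0 + \mathcal{O}(h^p)$ and, provided that $|h|$ is small enough, $$S_h = P_h \, e^{hD_h} \, P_h^{-1}.$$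
   Context: $\sigma(A)$ denotes the set of eigenvalues of a matrix $A$; for a set $X\subset\mathbb{C}$, $\overline{X}=\{\overline{z}: z\in X\}$. $N\ge 1$ and $p\ge 1$ are integers. *)

theory Defs
  imports
    "HOL-Analysis.Analysis"
    "HOL-Computational_Algebra.Polynomial"
    "HOL-Library.Landau_Symbols"
begin

definition eigenvalues :: "'a::comm_ring_1 ^ 'n ^ 'n \<Rightarrow> 'a set" where
  "eigenvalues A = {c. \<exists>v. v \<noteq> 0 \<and> A *v v = c *s v}"

text \<open>The characteristic polynomial \<open>det (X I - A)\<close>; the determinant is taken over the
  polynomial ring.\<close>

definition charpoly :: "'a::comm_ring_1 ^ 'n ^ 'n \<Rightarrow> 'a poly" where
  "charpoly A = det (mat [:0, 1:] - map_matrix (\<lambda>a. [:a:]) A)"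

text \<open>Simple means of algebraic multiplicity one.\<close>

definition simple_eigenvalue :: "'a::idom ^ 'n ^ 'n \<Rightarrow> 'a \<Rightarrow> bool" where
  "simple_eigenvalue A c \<longleftrightarrow> c \<in> eigenvalues A \<and> order c (charpoly A) = 1"

text \<open>Powers are formed with \<open>**\<close>, since \<open>*\<close> and \<open>^\<close> act componentwise on vectors.\<close>

definition matrix_exp :: "complex ^ 'n ^ 'n \<Rightarrow> complex ^ 'n ^ 'n" where
  "matrix_exp A = (\<Sum>k. (1 / fact k) *\<^sub>R (((**) A ^^ k) (mat 1)))"

definition real_diagonal :: "complex ^ 'n ^ 'n \<Rightarrow> bool" where
  "real_diagonal D \<longleftrightarrow> (\<forall>i j. D $ i $ j \<in> \<real> \<and> (i \<noteq> j \<longrightarrow> D $ i $ j = 0))"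

text \<open>Infinitely differentiable on the whole real line: every iterated derivative is again
  differentiable everywhere.\<close>

definition smooth :: "(real \<Rightarrow> 'a::real_normed_vector) \<Rightarrow> bool" where
  "smooth f \<longleftrightarrow>
     (\<forall>k t. ((\<lambda>g s. vector_derivative g (at s)) ^^ k) f differentiable (at t))"

end

theory Submission
  imports Defs "HOL-Computational_Algebra.Fundamental_Theorem_Algebra"
begin

text \<open>
  Its eigenvalues being simple, \<open>H\<close> has as many of them as its size allows and is therefore
  diagonalizable. After a change of basis the family becomes \<open>T h = V\<^sup>-\<^sup>1 S\<^sub>h V\<close>, which agrees
  with \<open>diag (exp (h l\<^sub>i))\<close> up to \<open>O(h\<^sup>p\<^sup>+\<^sup>1)\<close>. At \<open>h = 0\<close> all eigenvalues of \<open>T h\<close> collide at \<open>1\<close>, so perturbation theory cannot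
  be applied to \<open>T\<close> itself. The remedy is to divide by \<open>h\<close>: the quotient \<open>B h = (T h - 1) / h\<close>
  extends smoothly across \<open>0\<close> (\<open>hadamard_quotient\<close>), its value there is \<open>diag l\<close> with distinct
  entries, and for \<open>h \<noteq> 0\<close> it has the same eigenvectors as \<open>T h\<close>.

  Near \<open>0\<close> the eigenvalues \<open>\<mu>\<^sub>i h\<close> of \<open>B h\<close> are simple roots of a polynomial with smooth
  coefficients, hence smooth (\<open>smooth_simple_root\<close>); normalised eigenvectors are then obtained from
  Cramer's rule, hence smooth as well (\<open>smooth_diagonalization\<close>). This gives
  \<open>S\<^sub>h = P diag (1 + h \<mu>\<^sub>i h) P\<^sup>-\<^sup>1\<close>. The spectrum of \<open>S\<^sub>h\<close> is closed under conjugation, so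
  \<open>cnj (\<mu>\<^sub>i h)\<close> is some \<open>\<mu>\<^sub>j h\<close> whenever \<open>h \<noteq> 0\<close>; as \<open>\<mu>\<^sub>i h\<close> is close to the real number \<open>l\<^sub>i\<close>
  and the \<open>l\<^sub>i\<close> are distinct, \<open>j = i\<close> and \<open>\<mu>\<^sub>i h\<close> is real. The entries of \<open>D\<^sub>h\<close> are the
  smooth quotients \<open>ln (1 + h \<mu>\<^sub>i h) / h\<close> (\<open>smooth_logarithm\<close>).

  For the orders, the off-diagonal entries of \<open>B h\<close> are \<open>O(h\<^sup>p)\<close>, because division by \<open>h\<close> costs
  exactly one power. Reading \<open>B W = W diag \<mu>\<close> entry by entry transfers this to the off-diagonal
  entries of the eigenvector matrix and to \<open>\<mu>\<^sub>i h - (exp (h l\<^sub>i) - 1) / h\<close>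
  (\<open>diagonalization_order\<close>).

  All this takes place on a small interval, whereas \<open>D\<close> and \<open>P\<close> have to be smooth, real diagonal
  and invertible everywhere. Precomposing with a smooth map of the line into that interval which is
  the identity near \<open>0\<close> (\<open>smooth_retraction\<close>) settles this without losing any of these properties.
\<close>

section \<open>Finite orders of differentiability\<close>

text \<open>The derivative is only required to exist, instead of being the constant \<open>vector_derivative f\<close>:
  the closure properties below are proved by induction on \<open>n\<close>, exhibiting the derivative that the
  respective rule of calculus produces. Being \<open>n\<close> times continuously differentiable is the right
  notion for these inductions; smoothness alone gives no induction hypothesis to work with.\<close>

primrec ck_on :: "nat \<Rightarrow> real set \<Rightarrow> (real \<Rightarrow> 'a::real_normed_vector) \<Rightarrow> bool" where
  "ck_on 0 U f \<longleftrightarrow> continuous_on U f"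
| "ck_on (Suc n) U f \<longleftrightarrow>
     (\<exists>f'. (\<forall>t\<in>U. (f has_vector_derivative f' t) (at t)) \<and> ck_on n U f')"

definition smooth_on :: "real set \<Rightarrow> (real \<Rightarrow> 'a::real_normed_vector) \<Rightarrow> bool" where
  "smooth_on U f \<longleftrightarrow> (\<forall>n. ck_on n U f)"

lemma ck_on_SucI:
  "(\<And>t. t \<in> U \<Longrightarrow> (f has_vector_derivative f' t) (at t)) \<Longrightarrow> ck_on n U f' \<Longrightarrow> ck_on (Suc n) U f"
  by auto

lemma ck_on_imp_continuous: "ck_on n U f \<Longrightarrow> continuous_on U f"
  by (cases n)
     (auto intro!: continuous_at_imp_continuous_on elim: has_vector_derivative_continuous)

lemma ck_on_SucD: "ck_on (Suc n) U f \<Longrightarrow> ck_on n U f"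
proof (induction n arbitrary: f)
  case 0
  then show ?case using ck_on_imp_continuous by fastforce
next
  case (Suc n)
  then show ?case by (metis ck_on.simps(2))
qed

lemma ck_on_subset: "ck_on n U f \<Longrightarrow> V \<subseteq> U \<Longrightarrow> ck_on n V f"
proof (induction n arbitrary: f)
  case 0
  then show ?case by (auto intro: continuous_on_subset)
next
  case (Suc n)
  then show ?case by (metis ck_on.simps(2) subsetD)
qed

lemma smooth_on_subset: "smooth_on U f \<Longrightarrow> V \<subseteq> U \<Longrightarrow> smooth_on V f"
  by (auto simp: smooth_on_def intro: ck_on_subset[of _ U])

text \<open>Openness is essential: the derivative at a point of \<open>U\<close> is taken in the whole line.\<close>

lemma ck_on_cong:
  assumes "open U" "\<And>t. t \<in> U \<Longrightarrow> f t = g t" "ck_on n U f"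
  shows "ck_on n U g"
proof (cases n)
  case 0
  then show ?thesis using assms continuous_on_cong[of U U f g] by auto
next
  case (Suc m)
  then obtain f' where f': "\<And>t. t \<in> U \<Longrightarrow> (f has_vector_derivative f' t) (at t)" "ck_on m U f'"
    using assms by auto
  have "(g has_vector_derivative f' t) (at t)" if "t \<in> U" for t
    using has_vector_derivative_transform_within_open[OF f'(1)[OF that] assms(1) that] assms(2)
    by auto
  then show ?thesis using f' Suc by auto
qed

lemma ck_on_vector_derivative:
  assumes "open U" "ck_on (Suc n) U f"
  shows "ck_on n U (\<lambda>t. vector_derivative f (at t))"
proof -
  obtain f' where f': "\<And>t. t \<in> U \<Longrightarrow> (f has_vector_derivative f' t) (at t)" "ck_on n U f'"
    using assms by auto
  show ?thesis
    by (rule ck_on_cong[OF assms(1) _ f'(2)]) (simp add: vector_derivative_at[OF f'(1)])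
qed

lemma ck_on_Suc_has_vector_derivative:
  assumes "ck_on (Suc n) U f" "t \<in> U"
  shows "(f has_vector_derivative vector_derivative f (at t)) (at t)"
proof -
  obtain f' where "\<forall>t\<in>U. (f has_vector_derivative f' t) (at t)"
    using assms(1) by auto
  then show ?thesis using assms(2) vector_derivative_at by fastforce
qed

lemma ck_on_const: "ck_on n U (\<lambda>t. c)"
proof (induction n arbitrary: c)
  case (Suc n)
  then show ?case
    by (auto intro!: exI[of _ "\<lambda>t. 0"] derivative_eq_intros)
qed auto

lemma ck_on_bounded_linear:
  assumes "bounded_linear L" "ck_on n U f"
  shows "ck_on n U (\<lambda>t. L (f t))"
  using assms(2)
proof (induction n arbitrary: f)
  case 0
  then show ?case using assms(1) by (auto intro: bounded_linear.continuous_on)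
next
  case (Suc n)
  obtain f' where f': "\<And>t. t \<in> U \<Longrightarrow> (f has_vector_derivative f' t) (at t)" "ck_on n U f'"
    using Suc.prems(1) by auto
  then show ?case
    using bounded_linear.has_vector_derivative[OF assms(1)] Suc.IH f'
    by (intro ck_on_SucI[where f'="\<lambda>t. L (f' t)"]) auto
qed

lemma ck_on_add:
  assumes "ck_on n U f" "ck_on n U g"
  shows "ck_on n U (\<lambda>t. f t + g t)"
  using assms
proof (induction n arbitrary: f g)
  case 0
  then show ?case by (auto intro: continuous_intros)
next
  case (Suc n)
  obtain f' where f: "\<And>t. t \<in> U \<Longrightarrow> (f has_vector_derivative f' t) (at t)" "ck_on n U f'"
    using Suc.prems(1) by auto
  obtain g' where g: "\<And>t. t \<in> U \<Longrightarrow> (g has_vector_derivative g' t) (at t)" "ck_on n U g'"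
    using Suc.prems(2) by auto
  note fg = f g
  then show ?case
    using Suc.IH fg
    by (intro ck_on_SucI[where f'="\<lambda>t. f' t + g' t"]) (auto intro: has_vector_derivative_add)
qed

lemma ck_on_bilinear:
  assumes "bounded_bilinear B" "ck_on n U f" "ck_on n U g"
  shows "ck_on n U (\<lambda>t. B (f t) (g t))"
  using assms(2,3)
proof (induction n arbitrary: f g)
  case 0
  then show ?case using assms(1) by (auto intro: bounded_bilinear.continuous_on)
next
  case (Suc n)
  obtain f' where f: "\<And>t. t \<in> U \<Longrightarrow> (f has_vector_derivative f' t) (at t)" "ck_on n U f'"
    using Suc.prems(1) by auto
  obtain g' where g: "\<And>t. t \<in> U \<Longrightarrow> (g has_vector_derivative g' t) (at t)" "ck_on n U g'"
    using Suc.prems(2) by auto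
  note fg = f g
  have "ck_on n U (\<lambda>t. B (f t) (g' t) + B (f' t) (g t))"
    by (intro ck_on_add Suc.IH fg Suc.prems[THEN ck_on_SucD])
  with bounded_bilinear.has_vector_derivative[OF assms(1) fg(1) fg(3)] show ?case
    by (rule ck_on_SucI)
qed

lemma ck_on_mult:
  fixes f g :: "real \<Rightarrow> 'a::real_normed_algebra"
  shows "ck_on n U f \<Longrightarrow> ck_on n U g \<Longrightarrow> ck_on n U (\<lambda>t. f t * g t)"
  by (rule ck_on_bilinear[OF bounded_bilinear_mult])

lemma ck_on_uminus: "ck_on n U f \<Longrightarrow> ck_on n U (\<lambda>t. - f t)"
  by (rule ck_on_bounded_linear[OF bounded_linear_minus[OF bounded_linear_ident]])

lemma ck_on_diff: "ck_on n U f \<Longrightarrow> ck_on n U g \<Longrightarrow> ck_on n U (\<lambda>t. f t - g t)"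
  using ck_on_add[of n U f "\<lambda>t. - g t"] ck_on_uminus[of n U g] by simp

lemma ck_on_sum: "(\<And>i. i \<in> I \<Longrightarrow> ck_on n U (f i)) \<Longrightarrow> ck_on n U (\<lambda>t. \<Sum>i\<in>I. f i t)"
  by (induction I rule: infinite_finite_induct) (auto intro: ck_on_const ck_on_add)

lemma ck_on_prod:
  fixes f :: "'i \<Rightarrow> real \<Rightarrow> 'a::{real_normed_algebra_1,comm_monoid_mult}"
  shows "(\<And>i. i \<in> I \<Longrightarrow> ck_on n U (f i)) \<Longrightarrow> ck_on n U (\<lambda>t. \<Prod>i\<in>I. f i t)"
  by (induction I rule: infinite_finite_induct) (auto intro: ck_on_const ck_on_mult)

lemma ck_on_power:
  fixes f :: "real \<Rightarrow> 'a::real_normed_algebra_1"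
  shows "ck_on n U f \<Longrightarrow> ck_on n U (\<lambda>t. f t ^ k)"
  by (induction k) (auto intro: ck_on_const ck_on_mult)

lemma ck_on_ident: "ck_on n U (\<lambda>t. t)"
  by (cases n) (auto intro!: exI[of _ "\<lambda>t. 1"] ck_on_const has_vector_derivative_id)

lemma ck_on_of_real: "ck_on n U (\<lambda>t. complex_of_real t)"
  by (rule ck_on_bounded_linear[OF bounded_linear_of_real ck_on_ident])

text \<open>The derivative \<open>- f' / f\<^sup>2\<close> contains \<open>1 / f\<close> again, but is needed only to the next lower order, to
  which the induction hypothesis applies.\<close>

lemma ck_on_inverse:
  fixes f :: "real \<Rightarrow> 'a::{real_normed_field}"
  assumes "ck_on n U f" "\<And>t. t \<in> U \<Longrightarrow> f t \<noteq> 0"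
  shows "ck_on n U (\<lambda>t. inverse (f t))"
  using assms(1)
proof (induction n)
  case 0
  then show ?case using assms(2) by (auto intro: continuous_intros)
next
  case (Suc n)
  obtain f' where f': "\<And>t. t \<in> U \<Longrightarrow> (f has_vector_derivative f' t) (at t)" "ck_on n U f'"
    using Suc.prems(1) by auto
  let ?g = "\<lambda>t. - (inverse (f t) * f' t * inverse (f t))"
  have "((\<lambda>t. inverse (f t)) has_vector_derivative ?g t) (at t)" if "t \<in> U" for t
    using f'(1)[OF that] assms(2)[OF that] unfolding has_vector_derivative_def
    by (auto intro!: derivative_eq_intros)
  moreover have "ck_on n U ?g"
    by (intro ck_on_uminus ck_on_mult Suc.IH f' Suc.prems[THEN ck_on_SucD])
  ultimately show ?case by (rule ck_on_SucI)
qed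

lemma ck_on_divide:
  fixes f g :: "real \<Rightarrow> 'a::{real_normed_field}"
  shows "ck_on n U f \<Longrightarrow> ck_on n U g \<Longrightarrow> (\<And>t. t \<in> U \<Longrightarrow> g t \<noteq> 0) \<Longrightarrow> ck_on n U (\<lambda>t. f t / g t)"
  unfolding divide_inverse by (intro ck_on_mult ck_on_inverse)

lemma ck_on_compose:
  fixes \<phi> :: "real \<Rightarrow> real"
  assumes "ck_on n U f" "ck_on n W \<phi>" "\<And>t. t \<in> W \<Longrightarrow> \<phi> t \<in> U"
  shows "ck_on n W (\<lambda>t. f (\<phi> t))"
  using assms(1,2)
proof (induction n arbitrary: f)
  case 0
  then show ?case using assms(3) by (auto intro!: continuous_on_compose2[of U f W \<phi>])
next
  case (Suc n)
  obtain f' where f: "\<And>t. t \<in> U \<Longrightarrow> (f has_vector_derivative f' t) (at t)" "ck_on n U f'"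
    using Suc.prems(1) by auto
  obtain g' where g: "\<And>t. t \<in> W \<Longrightarrow> (\<phi> has_vector_derivative g' t) (at t)" "ck_on n W g'"
    using Suc.prems(2) by auto
  note fg = f g
  have "((\<lambda>t. f (\<phi> t)) has_vector_derivative g' t *\<^sub>R f' (\<phi> t)) (at t)" if "t \<in> W" for t
    using vector_diff_chain_at[OF fg(3)[OF that], of f] fg(1) assms(3)[OF that]
    by (auto simp: o_def)
  moreover have "ck_on n W (\<lambda>t. g' t *\<^sub>R f' (\<phi> t))"
    by (intro ck_on_bilinear[OF bounded_bilinear_scaleR] Suc.IH fg Suc.prems[THEN ck_on_SucD])
  ultimately show ?case by (rule ck_on_SucI)
qed

lemma ck_on_Ln:
  assumes "ck_on n U f" "\<And>t. t \<in> U \<Longrightarrow> f t \<notin> \<real>\<^sub>\<le>\<^sub>0"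
  shows "ck_on n U (\<lambda>t. Ln (f t))"
proof (cases n)
  case 0
  then show ?thesis using assms by (auto simp: continuous_on_def intro!: tendsto_Ln)
next
  case (Suc m)
  then obtain f' where f': "\<And>t. t \<in> U \<Longrightarrow> (f has_vector_derivative f' t) (at t)" "ck_on m U f'"
    using assms(1) by auto
  have nz: "f t \<noteq> 0" if "t \<in> U" for t using assms(2)[OF that] by auto
  have "((\<lambda>t. Ln (f t)) has_vector_derivative f' t * inverse (f t)) (at t)" if "t \<in> U" for t
    using field_vector_diff_chain_at[OF f'(1)[OF that] has_field_derivative_Ln[OF assms(2)[OF that]]]
    by (simp add: o_def)
  moreover have "ck_on m U f" by (rule ck_on_SucD) (use assms(1) Suc in blast)
  then have "ck_on m U (\<lambda>t. f' t * inverse (f t))"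
    by (intro ck_on_mult ck_on_inverse f' nz)
  ultimately show ?thesis unfolding Suc by (rule ck_on_SucI)
qed

lemma ck_on_vec:
  fixes f :: "real \<Rightarrow> 'a::real_normed_vector ^ 'n"
  assumes "\<And>i. ck_on n U (\<lambda>t. f t $ i)"
  shows "ck_on n U f"
proof -
  have "ck_on n U (\<lambda>t. \<Sum>i\<in>UNIV. axis i (f t $ i))"
  proof (intro ck_on_sum ck_on_bounded_linear[OF _ assms])
    fix i :: 'n
    show "bounded_linear (axis i :: 'a \<Rightarrow> _)"
      by (rule bounded_linear_intro[where K=1])
         (auto simp: vec_eq_iff axis_def norm_vec_def L2_set_def if_distrib[of norm] if_distrib[of "\<lambda>x. x\<^sup>2"] cong: if_cong)
  qed
  moreover have "(\<lambda>t. \<Sum>i\<in>UNIV. axis i (f t $ i)) = f"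
    by (auto simp: fun_eq_iff vec_eq_iff axis_def if_distrib cong: if_cong)
  ultimately show ?thesis by simp
qed

lemma smooth_on_iterated_derivative:
  assumes "open U" "smooth_on U f"
  shows "ck_on n U (((\<lambda>g s. vector_derivative g (at s)) ^^ k) f)"
proof (induction k arbitrary: n)
  case 0
  show ?case using assms(2) by (simp add: smooth_on_def)
next
  case (Suc k)
  show ?case using ck_on_vector_derivative[OF assms(1) Suc] by simp
qed

lemma smooth_on_UNIV_iff: "smooth_on UNIV f \<longleftrightarrow> smooth f"
proof
  assume "smooth_on UNIV f"
  then show "smooth f"
    unfolding smooth_def
    using ck_on_Suc_has_vector_derivative[OF smooth_on_iterated_derivative[OF open_UNIV] UNIV_I]
    by (blast intro: differentiableI_vector)
next
  assume *: "smooth f"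
  let ?d = "\<lambda>g s. vector_derivative g (at s)"
  have d: "((?d ^^ k) f has_vector_derivative (?d ^^ Suc k) f t) (at t)" for k t
    using * by (auto simp: smooth_def vector_derivative_works)
  have "ck_on n UNIV ((?d ^^ k) f)" for n k
  proof (induction n arbitrary: k)
    case 0
    show ?case unfolding ck_on.simps
      using d by (meson continuous_at_imp_continuous_on has_vector_derivative_continuous)
  next
    case (Suc n)
    show ?case unfolding ck_on.simps using d Suc by blast
  qed
  then have "ck_on n UNIV ((?d ^^ 0) f)" for n by blast
  then show "smooth_on UNIV f" by (simp add: smooth_on_def)
qed

lemma smooth_on_continuous_at_0:
  assumes "smooth_on {-\<epsilon><..<\<epsilon>} f" "0 < \<epsilon>"
  shows "(f \<longlongrightarrow> f 0) (at 0)"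
proof -
  have "ck_on 0 {-\<epsilon><..<\<epsilon>} f" using assms(1) by (simp only: smooth_on_def)
  then have "isCont f 0" using assms(2) by (simp add: continuous_on_eq_continuous_at)
  then show ?thesis by (simp add: isCont_def)
qed

section \<open>A smooth map into a small interval\<close>

text \<open>The classical flat function \<open>exp (-1/t)\<close>, extended by \<open>0\<close>. The polynomial factor makes the family
  closed under differentiation, so that smoothness becomes a plain induction.\<close>

definition flat :: "real poly \<Rightarrow> real \<Rightarrow> real" where
  "flat q t = (if t > 0 then poly q (1 / t) * exp (- 1 / t) else 0)"

lemma flat_has_derivative:
  "(flat q has_vector_derivative flat ([:0, 0, 1:] * (q - pderiv q)) t) (at t)"
proof -
  consider "t > 0" | "t < 0" | "t = 0" by linarith
  then show ?thesis
  proof cases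
    case 1
    have "((\<lambda>t. poly q (1 / t) * exp (- 1 / t)) has_real_derivative
          flat ([:0, 0, 1:] * (q - pderiv q)) t) (at t)"
      using 1 by (auto intro!: derivative_eq_intros simp: flat_def field_simps power2_eq_square)
    then have "(flat q has_real_derivative flat ([:0, 0, 1:] * (q - pderiv q)) t) (at t)"
      by (rule has_field_derivative_transform_within_open[where S="{0<..}"])
         (use 1 in \<open>auto simp: flat_def\<close>)
    then show ?thesis by (simp add: has_real_derivative_iff_has_vector_derivative)
  next
    case 2
    have "((\<lambda>t. 0) has_real_derivative flat ([:0, 0, 1:] * (q - pderiv q)) t) (at t)"
      using 2 by (auto simp: flat_def)
    then have "(flat q has_real_derivative flat ([:0, 0, 1:] * (q - pderiv q)) t) (at t)"
      by (rule has_field_derivative_transform_within_open[where S="{..<0}"])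
         (use 2 in \<open>auto simp: flat_def\<close>)
    then show ?thesis by (simp add: has_real_derivative_iff_has_vector_derivative)
  next
    case 3
    have lim: "((\<lambda>x. poly r x * exp (- x)) \<longlongrightarrow> 0) at_top" for r :: "real poly"
    proof -
      have "((\<lambda>x. \<Sum>i\<le>degree r. coeff r i * (x ^ i / exp x)) \<longlongrightarrow> (\<Sum>i\<le>degree r. coeff r i * 0)) at_top"
        by (intro tendsto_intros tendsto_power_div_exp_0)
      then show ?thesis
        by (simp add: poly_altdef sum_distrib_right exp_minus divide_inverse mult.assoc)
    qed
    have "((\<lambda>t. poly (pCons 0 q) (inverse t) * exp (- inverse t)) \<longlongrightarrow> 0) (at_right 0)"
      by (rule filterlim_compose[OF lim filterlim_inverse_at_top_right])
    then have R: "((\<lambda>t. flat q t / t) \<longlongrightarrow> 0) (at_right 0)"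
      by (rule Lim_transform_eventually)
         (auto simp: eventually_at_filter flat_def field_simps)
    have L: "((\<lambda>t. flat q t / t) \<longlongrightarrow> 0) (at_left 0)"
      by (rule Lim_transform_eventually[OF tendsto_const])
         (auto simp: eventually_at_filter flat_def)
    have "((\<lambda>t. flat q t / t) \<longlongrightarrow> 0) (at 0)"
      using L R by (simp add: filterlim_split_at)
    then have "(flat q has_real_derivative 0) (at 0)"
      by (simp add: has_field_derivative_iff flat_def[of q 0])
    then show ?thesis using 3
      by (simp add: has_real_derivative_iff_has_vector_derivative flat_def)
  qed
qed

lemma ck_on_flat: "ck_on n U (flat q)"
proof (induction n arbitrary: q)
  case 0
  show ?case unfolding ck_on.simps
    using flat_has_derivative
    by (meson continuous_at_imp_continuous_on has_vector_derivative_continuous)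
next
  case (Suc n)
  then show ?case using flat_has_derivative unfolding ck_on.simps by blast
qed

text \<open>The map is \<open>t \<chi>(t)\<close> with a cut-off function \<open>\<chi>\<close> that is \<open>1\<close> on \<open>[-\<epsilon>/2, \<epsilon>/2]\<close> and \<open>0\<close> outside
  \<open>(-\<epsilon>, \<epsilon>)\<close>; as \<open>0 \<le> \<chi> \<le> 1\<close>, the product stays below \<open>\<epsilon>\<close> everywhere.\<close>

lemma smooth_retraction:
  assumes "\<epsilon> > 0"
  obtains \<phi> :: "real \<Rightarrow> real" where
    "smooth_on UNIV \<phi>" "\<And>t. \<bar>\<phi> t\<bar> < \<epsilon>" "\<And>t. \<bar>t\<bar> < \<epsilon> / 2 \<Longrightarrow> \<phi> t = t"
proof
  let ?f = "flat 1"
  let ?a = "\<lambda>t::real. ?f (\<epsilon>\<^sup>2 - t\<^sup>2)" and ?b = "\<lambda>t::real. ?f (t\<^sup>2 - (\<epsilon> / 2)\<^sup>2)"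
  let ?\<phi> = "\<lambda>t. t * (?a t / (?a t + ?b t))"
  have nn: "?f t \<ge> 0" and pos: "t > 0 \<Longrightarrow> ?f t > 0" and zero: "t \<le> 0 \<Longrightarrow> ?f t = 0" for t
    by (auto simp: flat_def)
  have den: "?a t + ?b t > 0" for t
  proof -
    have "(\<epsilon> / 2)\<^sup>2 < \<epsilon>\<^sup>2" using assms by (simp add: power2_eq_square)
    then consider "\<epsilon>\<^sup>2 - t\<^sup>2 > 0" | "t\<^sup>2 - (\<epsilon> / 2)\<^sup>2 > 0" by linarith
    then show ?thesis using nn pos by cases (auto intro: add_pos_nonneg add_nonneg_pos)
  qed
  have ck: "ck_on n UNIV ?a" "ck_on n UNIV ?b" for n
    by (intro ck_on_compose[OF ck_on_flat[of n UNIV]] ck_on_diff ck_on_power ck_on_ident ck_on_const; simp)+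
  then show "smooth_on UNIV ?\<phi>"
    unfolding smooth_on_def using den
    by (intro allI ck_on_mult ck_on_divide ck_on_add ck_on_ident) (auto simp: less_imp_neq[THEN not_sym])
  show "\<bar>?\<phi> t\<bar> < \<epsilon>" for t
  proof (cases "\<bar>t\<bar> < \<epsilon>")
    case True
    have "?a t / (?a t + ?b t) \<le> 1" "0 \<le> ?a t / (?a t + ?b t)"
      using den[of t] nn by (auto simp: divide_simps)
    then have "\<bar>?\<phi> t\<bar> \<le> \<bar>t\<bar> * 1"
      unfolding abs_mult[of t] by (intro mult_left_mono) (simp_all del: abs_divide)
    then show ?thesis using True by linarith
  next
    case False
    then have "\<epsilon>\<^sup>2 \<le> t\<^sup>2" using assms by (metis abs_le_square_iff abs_of_pos not_less)
    then show ?thesis using zero assms by simp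
  qed
  show "?\<phi> t = t" if "\<bar>t\<bar> < \<epsilon> / 2" for t
  proof -
    have "t\<^sup>2 \<le> (\<epsilon> / 2)\<^sup>2" using that assms by (simp flip: abs_le_square_iff)
    then have "?b t = 0" using zero by simp
    then show ?thesis using den[of t] by simp
  qed
qed

section \<open>Division by the variable\<close>

lemma has_vector_derivative_iff_slope:
  "(f has_vector_derivative f') (at x) \<longleftrightarrow> ((\<lambda>y. (f y - f x) /\<^sub>R (y - x)) \<longlongrightarrow> f') (at x)"
proof -
  have "norm (f y - f x - (y - x) *\<^sub>R f') / norm (y - x) = norm ((f y - f x) /\<^sub>R (y - x) - f')"
    if "y \<noteq> x" for y
  proof -
    have "f y - f x - (y - x) *\<^sub>R f' = (y - x) *\<^sub>R ((f y - f x) /\<^sub>R (y - x) - f')"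
      using that by (simp add: scaleR_diff_right)
    then show ?thesis using that by (simp only: norm_scaleR) simp
  qed
  then have "((\<lambda>y. norm (f y - f x - (y - x) *\<^sub>R f') / norm (y - x)) \<longlongrightarrow> 0) (at x) \<longleftrightarrow>
      ((\<lambda>y. norm ((f y - f x) /\<^sub>R (y - x) - f')) \<longlongrightarrow> 0) (at x)"
    by (intro filterlim_cong) (auto simp: eventually_at_filter)
  also have "\<dots> \<longleftrightarrow> ((\<lambda>y. (f y - f x) /\<^sub>R (y - x)) \<longlongrightarrow> f') (at x)"
    by (simp only: tendsto_norm_zero_iff LIM_zero_iff)
  finally show ?thesis
    by (simp only: has_vector_derivative_def has_derivative_iff_norm bounded_linear_scaleR_left simp_thms)
qed

lemma has_vector_derivative_compose_mult:
  assumes "(f has_vector_derivative f') (at (t * x))"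
  shows "((\<lambda>x. f (t * x)) has_vector_derivative t *\<^sub>R f') (at x)"
  using vector_diff_chain_at[of "(*) t" t x f f'] assms DERIV_cmult_Id[of t x UNIV]
  by (simp add: o_def has_real_derivative_iff_has_vector_derivative)

text \<open>The quotient is \<open>g h = \<integral>\<^sub>0\<^sup>1 f' (t h) dt\<close>, by the fundamental theorem of calculus along the segment
  from \<open>0\<close> to \<open>h\<close>. It is smooth because differentiation under the integral sign leads to integrals
  of the same shape, with \<open>t\<^sup>k f\<^sup>(\<^sup>k\<^sup>+\<^sup>1\<^sup>) (t h)\<close> as integrand.\<close>

lemma hadamard_quotient:
  fixes f :: "real \<Rightarrow> 'a::banach"
  assumes "smooth_on {-r<..<r} f" "f 0 = 0"
  obtains g where "smooth_on {-r<..<r} g" "\<And>h. \<bar>h\<bar> < r \<Longrightarrow> f h = h *\<^sub>R g h"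
proof -
  let ?U = "{-r<..<r}"
  define F where "F k = ((\<lambda>g s. vector_derivative g (at s)) ^^ k) f" for k
  have ckF: "ck_on n ?U (F k)" for n k
    unfolding F_def using assms(1) by (intro smooth_on_iterated_derivative) simp
  have dF: "(F k has_vector_derivative F (Suc k) t) (at t)" if "t \<in> ?U" for k t
    using ck_on_Suc_has_vector_derivative[OF ckF that] by (simp add: F_def)
  have cF: "continuous_on ?U (F k)" for k
    using ckF[of 0 k] by simp
  have F0: "F 0 = f" by (simp add: F_def)
  have sc: "t * h \<in> ?U" if "t \<in> {0..1}" "h \<in> ?U" for t h
  proof -
    have "\<bar>t\<bar> * \<bar>h\<bar> \<le> 1 * \<bar>h\<bar>" using that by (intro mult_right_mono) auto
    moreover have "\<bar>h\<bar> < r" using that by auto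
    ultimately have "\<bar>t * h\<bar> < r" by (simp only: abs_mult)
    then show ?thesis by (simp only: abs_less_iff greaterThanLessThan_iff minus_less_iff simp_thms)
  qed
  define G where "G k h = integral (cbox 0 1) (\<lambda>t. t ^ k *\<^sub>R F (Suc k) (t * h))" for k h
  have dG: "(G k has_vector_derivative G (Suc k) h) (at h)" if "h \<in> ?U" for k h
  proof -
    have "((\<lambda>h. integral (cbox 0 1) (\<lambda>t. t ^ k *\<^sub>R F (Suc k) (t * h))) has_vector_derivative
            integral (cbox 0 1) (\<lambda>t. t ^ Suc k *\<^sub>R F (Suc (Suc k)) (t * h))) (at h within ?U)"
    proof (rule leibniz_rule_vector_derivative)
      fix x t :: real assume x: "x \<in> ?U" and t: "t \<in> cbox 0 1"
      have "((\<lambda>x. F (Suc k) (t * x)) has_vector_derivative t *\<^sub>R F (Suc (Suc k)) (t * x)) (at x)"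
        using x t sc by (intro has_vector_derivative_compose_mult dF) auto
      from bounded_linear.has_vector_derivative[OF bounded_linear_scaleR_right this, of "t ^ k"]
      have "((\<lambda>x. t ^ k *\<^sub>R F (Suc k) (t * x)) has_vector_derivative
          t ^ Suc k *\<^sub>R F (Suc (Suc k)) (t * x)) (at x)"
        by (simp only: scaleR_scaleR power_Suc2)
      then show "((\<lambda>x. t ^ k *\<^sub>R F (Suc k) (t * x)) has_vector_derivative
          t ^ Suc k *\<^sub>R F (Suc (Suc k)) (t * x)) (at x within ?U)"
        by (rule has_vector_derivative_at_within)
    next
      fix x assume x: "x \<in> ?U"
      show "(\<lambda>t. t ^ k *\<^sub>R F (Suc k) (t * x)) integrable_on cbox 0 1"
        using sc x
        by (intro integrable_continuous continuous_intros continuous_on_compose2[OF cF]) auto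
    next
      show "continuous_on (?U \<times> cbox 0 1) (\<lambda>(x, t). t ^ Suc k *\<^sub>R F (Suc (Suc k)) (t * x))"
        unfolding split_beta using sc
        by (intro continuous_intros continuous_on_compose2[OF cF]) auto
    qed (use that in auto)
    then show ?thesis
      unfolding G_def at_within_open[OF that open_greaterThanLessThan] .
  qed
  have "ck_on n ?U (G k)" for n k
  proof (induction n arbitrary: k)
    case 0
    show ?case unfolding ck_on.simps
      by (intro continuous_at_imp_continuous_on ballI has_vector_derivative_continuous[OF dG])
  next
    case (Suc n)
    show ?case by (rule ck_on_SucI[OF dG Suc])
  qed
  moreover have "f h = h *\<^sub>R G 0 h" if h: "\<bar>h\<bar> < r" for h
  proof -
    have "((\<lambda>t. h *\<^sub>R F 1 (t * h)) has_integral (f (1 * h) - f (0 * h))) {0..1}"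
    proof (rule fundamental_theorem_of_calculus)
      fix t :: real assume t: "t \<in> {0..1}"
      have "((\<lambda>t. F 0 (h * t)) has_vector_derivative h *\<^sub>R F 1 (t * h)) (at t)"
        using dF[of "t * h" 0] sc[of t h] t h
        by (intro has_vector_derivative_compose_mult) (simp add: mult.commute abs_less_iff)
      then show "((\<lambda>t. f (t * h)) has_vector_derivative h *\<^sub>R F 1 (t * h)) (at t within {0..1})"
        unfolding F0 mult.commute[of h] by (rule has_vector_derivative_at_within)
    qed simp
    from integral_unique[OF this] have "f h = integral {0..1} (\<lambda>t. h *\<^sub>R F 1 (t * h))"
      by (simp only: assms(2) mult_1 mult_zero_left diff_zero)
    also have "\<dots> = h *\<^sub>R integral {0..1} (\<lambda>t. F 1 (t * h))"
      by (rule integral_cmul)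
    finally show ?thesis by (simp add: G_def)
  qed
  ultimately show ?thesis
    by (intro that[of "G 0"]) (auto simp: smooth_on_def)
qed

section \<open>Smooth dependence of simple roots\<close>

text \<open>The divided difference \<open>(q z - q w) / (z - w)\<close> of the polynomial \<open>q z = \<Sum>k\<le>N. a k * z ^ k\<close>,
  written so that it makes sense (and is continuous) for \<open>z = w\<close>, where it is \<open>q' z\<close>.\<close>

definition divdiff :: "nat \<Rightarrow> (nat \<Rightarrow> 'a::comm_ring_1) \<Rightarrow> 'a \<Rightarrow> 'a \<Rightarrow> 'a" where
  "divdiff N a z w = (\<Sum>k\<le>N. a k * (\<Sum>i<k. w ^ (k - Suc i) * z ^ i))"

lemma divdiff_eq:
  fixes a :: "nat \<Rightarrow> 'a::comm_ring_1"
  shows "(\<Sum>k\<le>N. a k * z ^ k) - (\<Sum>k\<le>N. a k * w ^ k) = (z - w) * divdiff N a z w"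
proof -
  have "z ^ k - w ^ k = (z - w) * (\<Sum>i<k. w ^ (k - Suc i) * z ^ i)" for k
    by (rule power_diff_sumr2)
  then have "a k * z ^ k - a k * w ^ k = (z - w) * (a k * (\<Sum>i<k. w ^ (k - Suc i) * z ^ i))" for k
    by (metis mult.left_commute right_diff_distrib)
  then show ?thesis
    by (simp only: divdiff_def sum_distrib_left[of "z - w"] flip: sum_subtractf)
qed

text \<open>The modulus of a monic polynomial at \<open>z\<close> is the product of the distances from \<open>z\<close> to its roots;
  if it is below \<open>\<delta> ^ degree p\<close>, one of these distances is below \<open>\<delta>\<close>.\<close>

lemma monic_poly_root_near:
  fixes p :: "complex poly"
  assumes "lead_coeff p = 1" "degree p > 0" "norm (poly p z) < \<delta> ^ degree p" "\<delta> > 0"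
  shows "\<exists>w. poly p w = 0 \<and> norm (w - z) < \<delta>"
proof (rule ccontr)
  assume *: "\<not> ?thesis"
  obtain root where "smult (lead_coeff p) (\<Prod>i<degree p. [:- root i, 1:]) = p"
    by (rule complex_poly_decompose')
  then have "p = (\<Prod>i<degree p. [:- root i, 1:])"
    using assms(1) by simp
  then have p: "poly p w = (\<Prod>i<degree p. w - root i)" for w
    using poly_prod[of "\<lambda>i. [:- root i, 1:]" "{..<degree p}" w] by simp
  have "norm (root i - z) \<ge> \<delta>" if "i < degree p" for i
  proof -
    have "poly p (root i) = 0" unfolding p using that by (intro prod_zero) auto
    then show ?thesis using * by (meson not_less)
  qed
  then have "\<delta> ^ degree p \<le> (\<Prod>i<degree p. norm (z - root i))"
    using prod_mono[of "{..<degree p}" "\<lambda>_. \<delta>" "\<lambda>i. norm (z - root i)"] assms(4)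
    by (auto simp: norm_minus_commute)
  then show False using assms(3) by (simp add: p prod_norm)
qed

lemma isCont_imp_tendsto_nhds: "isCont f x \<Longrightarrow> (f \<longlongrightarrow> f x) (nhds x)"
  by (simp only: isCont_def tendsto_at_iff_tendsto_nhds)

text \<open>A simple root of a polynomial depends smoothly on the coefficients. Everything rests on the
  identity \<open>q\<^sub>h(z) - q\<^sub>h(w) = (z - w) Q\<^sub>h(z, w)\<close> with the divided difference \<open>Q\<close>. Simplicity says
  \<open>Q\<^sub>0(z\<^sub>0, z\<^sub>0) \<noteq> 0\<close>, so \<open>Q\<close> is bounded away from \<open>0\<close> near that point. For roots \<open>\<mu> h\<close> and \<open>\<mu> k\<close>
  near \<open>z\<^sub>0\<close> the identity gives
  \<open>\<mu> h - \<mu> k = - (q\<^sub>h(\<mu> k) - q\<^sub>k(\<mu> k)) / Q\<^sub>h(\<mu> h, \<mu> k)\<close>, which yields first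
  continuity of \<open>\<mu>\<close> and then the derivative
  \<open>\<mu>' = - (\<partial>q/\<partial>h)(\<mu>) / Q(\<mu>, \<mu>)\<close>. The latter is as often differentiable as \<open>\<mu>\<close>, so
  smoothness follows by bootstrapping. The root at \<open>h = 0\<close> is \<open>z\<^sub>0\<close> itself, as the nonvanishing of
  \<open>Q\<close> leaves room for only one root near \<open>z\<^sub>0\<close>.\<close>

lemma smooth_simple_root:
  fixes a :: "nat \<Rightarrow> real \<Rightarrow> complex"
  assumes r: "r > 0"
    and smooth: "\<And>k. smooth_on {-r<..<r} (a k)"
    and monic: "\<And>h. a N h = 1"
    and root: "(\<Sum>k\<le>N. a k 0 * z0 ^ k) = 0"
    and simple: "divdiff N (\<lambda>k. a k 0) z0 z0 \<noteq> 0"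
  obtains \<mu> \<epsilon> where "0 < \<epsilon>" "\<epsilon> \<le> r" "smooth_on {-\<epsilon><..<\<epsilon>} \<mu>" "\<mu> 0 = z0"
    "\<And>h. \<bar>h\<bar> < \<epsilon> \<Longrightarrow> (\<Sum>k\<le>N. a k h * \<mu> h ^ k) = 0"
proof -
  let ?q = "\<lambda>z h. \<Sum>k\<le>N. a k h * z ^ k"
  let ?Q = "\<lambda>z w h. divdiff N (\<lambda>k. a k h) z w"
  have "N > 0" using root monic by (cases N) auto
  have ca: "continuous_on {-r<..<r} (a k)" for k
    using smooth by (auto simp: smooth_on_def intro: ck_on_imp_continuous)
  have ia: "isCont (a k) h" if "\<bar>h\<bar> < r" for k h
    using ca[of k] that by (simp add: continuous_on_eq_continuous_at abs_less_iff)
  define c where "c = norm (?Q z0 z0 0) / 2"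
  have c: "c > 0" using simple by (simp add: c_def)
  let ?G = "\<lambda>x :: complex \<times> complex \<times> real. norm (?Q (fst x) (fst (snd x)) (snd (snd x)))"
  have "isCont (\<lambda>x :: complex \<times> complex \<times> real. a k (snd (snd x))) (z0, z0, 0)" for k
    by (rule isCont_o2[where g="a k" and f="\<lambda>x. snd (snd x)"]) (use r ia in auto)
  then have "isCont ?G (z0, z0, 0)"
    unfolding divdiff_def by (auto intro!: continuous_intros)
  then have "(?G \<longlongrightarrow> ?G (z0, z0, 0)) (nhds (z0, z0, 0))"
    by (rule isCont_imp_tendsto_nhds)
  moreover have "c < ?G (z0, z0, 0)" using simple by (simp add: c_def)
  ultimately have "eventually (\<lambda>x. c < ?G x) (nhds (z0, z0, 0))"
    by (rule order_tendstoD)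
  then obtain \<eta> where \<eta>: "\<eta> > 0" "\<And>x. dist x (z0, z0, 0) < \<eta> \<Longrightarrow> c < norm (?Q (fst x) (fst (snd x)) (snd (snd x)))"
    unfolding eventually_nhds_metric by blast
  define \<delta> where "\<delta> = \<eta> / 3"
  have \<delta>: "\<delta> > 0" using \<eta> by (simp add: \<delta>_def)
  \<comment> \<open>The divided difference exceeds \<open>c\<close> on a product of \<open>\<delta>\<close>-balls.\<close>
  have Q: "c < norm (?Q z w h)" if "norm (z - z0) < \<delta>" "norm (w - z0) < \<delta>" "\<bar>h\<bar> < \<delta>" for z w h
  proof -
    have "dist (z, w, h) (z0, z0, 0) \<le> dist z z0 + (dist w z0 + dist h 0)"
      unfolding dist_Pair_Pair
      using sqrt_sum_squares_le_sum_abs[of "dist z z0" "sqrt ((dist w z0)\<^sup>2 + (dist h 0)\<^sup>2)"]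
        sqrt_sum_squares_le_sum_abs[of "dist w z0" "dist h 0"] by simp
    also have "\<dots> < \<eta>" using that by (simp add: dist_norm \<delta>_def)
    finally show ?thesis using \<eta>(2)[of "(z, w, h)"] by simp
  qed
  have "isCont (\<lambda>h. norm (?q z0 h)) 0"
    by (intro continuous_intros ia) (use r in auto)
  then have "((\<lambda>h. norm (?q z0 h)) \<longlongrightarrow> norm (?q z0 0)) (nhds 0)"
    by (rule isCont_imp_tendsto_nhds)
  moreover have "norm (?q z0 0) < \<delta> ^ N" using root \<delta> by simp
  ultimately have "eventually (\<lambda>h. norm (?q z0 h) < \<delta> ^ N) (nhds 0)"
    by (rule order_tendstoD)
  then obtain \<eta>' where \<eta>': "\<eta>' > 0" "\<And>h. \<bar>h\<bar> < \<eta>' \<Longrightarrow> norm (?q z0 h) < \<delta> ^ N"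
    by (auto simp: eventually_nhds_metric dist_real_def)
  define \<epsilon> where "\<epsilon> = min r (min \<delta> \<eta>')"
  have \<epsilon>: "0 < \<epsilon>" "\<epsilon> \<le> r" "\<epsilon> \<le> \<delta>" "\<epsilon> \<le> \<eta>'" using r \<delta> \<eta>' by (auto simp: \<epsilon>_def)
  have "\<exists>z. ?q z h = 0 \<and> norm (z - z0) < \<delta>" if h: "\<bar>h\<bar> < \<epsilon>" for h
  proof -
    let ?p = "\<Sum>k\<le>N. monom (a k h) k"
    have coeff: "coeff ?p k = (if k \<le> N then a k h else 0)" for k
      by (simp add: coeff_sum if_distrib cong: if_cong)
    have deg: "degree ?p = N"
      using coeff monic by (intro antisym degree_le le_degree) auto
    have p: "poly ?p z = ?q z h" for z by (simp add: poly_sum poly_monom)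
    show ?thesis
      using monic_poly_root_near[of ?p z0 \<delta>] deg coeff[of N] monic \<open>N > 0\<close> \<delta> \<eta>'(2)[of h] h \<epsilon> p
      by simp
  qed
  then obtain \<mu> where \<mu>: "\<And>h. \<bar>h\<bar> < \<epsilon> \<Longrightarrow> ?q (\<mu> h) h = 0 \<and> norm (\<mu> h - z0) < \<delta>"
    by metis
  have Q\<mu>: "c < norm (?Q (\<mu> h) (\<mu> k) h)" if "\<bar>h\<bar> < \<epsilon>" "\<bar>k\<bar> < \<epsilon>" for h k
    using Q \<mu> that \<epsilon> by auto
  have \<mu>0: "\<mu> 0 = z0"
  proof -
    have "(\<mu> 0 - z0) * ?Q (\<mu> 0) z0 0 = 0"
      using divdiff_eq[of "\<lambda>k. a k 0" "\<mu> 0" N z0] \<mu>[of 0] \<epsilon> root by simp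
    moreover have "?Q (\<mu> 0) z0 0 \<noteq> 0" using Q[of "\<mu> 0" z0 0] \<mu>[of 0] \<epsilon> \<delta> c by auto
    ultimately show ?thesis by simp
  qed
  have diff: "\<mu> h - \<mu> k = - ((?q (\<mu> k) h - ?q (\<mu> k) k) / ?Q (\<mu> h) (\<mu> k) h)" if "\<bar>h\<bar> < \<epsilon>" "\<bar>k\<bar> < \<epsilon>" for h k
  proof -
    have "(\<mu> h - \<mu> k) * ?Q (\<mu> h) (\<mu> k) h = - (?q (\<mu> k) h - ?q (\<mu> k) k)"
      using divdiff_eq[of "\<lambda>k. a k h" "\<mu> h" N "\<mu> k"] \<mu> that by simp
    moreover have "?Q (\<mu> h) (\<mu> k) h \<noteq> 0" using Q\<mu>[OF that] c by auto
    ultimately show ?thesis by (simp add: field_simps)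
  qed
  have cont: "isCont \<mu> k" if k: "\<bar>k\<bar> < \<epsilon>" for k
  proof -
    have "isCont (\<lambda>h. ?q (\<mu> k) h - ?q (\<mu> k) k) k"
      by (intro continuous_intros ia) (use k \<epsilon> in auto)
    then have "((\<lambda>h. ?q (\<mu> k) h - ?q (\<mu> k) k) \<longlongrightarrow> 0) (at k)"
      by (simp add: isCont_def)
    then have lim: "((\<lambda>h. norm (?q (\<mu> k) h - ?q (\<mu> k) k) / c) \<longlongrightarrow> 0) (at k)"
      by (intro tendsto_divide_zero tendsto_norm_zero)
    have "eventually (\<lambda>h. norm (\<mu> h - \<mu> k) \<le> norm (?q (\<mu> k) h - ?q (\<mu> k) k) / c) (at k)"
    proof -
      have "eventually (\<lambda>h. h \<in> {-\<epsilon><..<\<epsilon>}) (at k)"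
        using k by (intro eventually_at_in_open') auto
      then show ?thesis
      proof eventually_elim
        case (elim h)
        then have h: "\<bar>h\<bar> < \<epsilon>" by auto
        show ?case unfolding diff[OF h k] norm_minus_cancel norm_divide
          using Q\<mu>[OF h k] c by (intro divide_left_mono mult_pos_pos) auto
      qed
    qed
    from Lim_null_comparison[OF this lim] show ?thesis
      unfolding isCont_def by (rule LIM_zero_cancel)
  qed
  define a' where "a' k = (\<lambda>t. vector_derivative (a k) (at t))" for k
  have da: "(a k has_vector_derivative a' k t) (at t)" if "\<bar>t\<bar> < r" for k t
    unfolding a'_def
    by (rule ck_on_Suc_has_vector_derivative[OF smooth[unfolded smooth_on_def, rule_format]])
       (use that in auto)
  have cka: "ck_on n {-\<epsilon><..<\<epsilon>} (a k)" "ck_on n {-\<epsilon><..<\<epsilon>} (a' k)" for n k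
  proof -
    have sub: "{-\<epsilon><..<\<epsilon>} \<subseteq> {-r<..<r}" using \<epsilon> by auto
    show "ck_on n {-\<epsilon><..<\<epsilon>} (a k)"
      using smooth[of k] unfolding smooth_on_def by (intro ck_on_subset[OF _ sub]) blast
    have "ck_on n {-r<..<r} (a' k)"
      unfolding a'_def
      by (intro ck_on_vector_derivative smooth[unfolded smooth_on_def, rule_format]) simp
    then show "ck_on n {-\<epsilon><..<\<epsilon>} (a' k)" by (rule ck_on_subset[OF _ sub])
  qed
  \<comment> \<open>Implicit differentiation of \<open>q\<^sub>h(\<mu> h) = 0\<close>.\<close>
  define \<mu>' where "\<mu>' h = - ((\<Sum>k\<le>N. a' k h * \<mu> h ^ k) / ?Q (\<mu> h) (\<mu> h) h)" for h
  have d\<mu>: "(\<mu> has_vector_derivative \<mu>' k) (at k)" if "k \<in> {-\<epsilon><..<\<epsilon>}" for k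
  proof -
    have k: "\<bar>k\<bar> < \<epsilon>" using that by auto
    have "((\<lambda>h. ?q (\<mu> k) h) has_vector_derivative (\<Sum>j\<le>N. a' j k * \<mu> k ^ j)) (at k)"
      by (intro has_vector_derivative_sum has_vector_derivative_mult_left da) (use k \<epsilon> in auto)
    then have L1: "((\<lambda>h. (?q (\<mu> k) h - ?q (\<mu> k) k) /\<^sub>R (h - k)) \<longlongrightarrow> (\<Sum>j\<le>N. a' j k * \<mu> k ^ j)) (at k)"
      by (simp only: has_vector_derivative_iff_slope)
    have L2: "((\<lambda>h. ?Q (\<mu> h) (\<mu> k) h) \<longlongrightarrow> ?Q (\<mu> k) (\<mu> k) k) (at k)"
    proof -
      have "isCont (\<lambda>h. ?Q (\<mu> h) (\<mu> k) h) k" unfolding divdiff_def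
        by (intro continuous_intros cont ia) (use k \<epsilon> in auto)
      then show ?thesis by (simp add: isCont_def)
    qed
    have "?Q (\<mu> k) (\<mu> k) k \<noteq> 0" using Q\<mu>[OF k k] c by auto
    with L1 L2 have "((\<lambda>h. - (((?q (\<mu> k) h - ?q (\<mu> k) k) /\<^sub>R (h - k)) / ?Q (\<mu> h) (\<mu> k) h)) \<longlongrightarrow> \<mu>' k) (at k)"
      unfolding \<mu>'_def by (intro tendsto_minus tendsto_divide)
    then have "((\<lambda>h. (\<mu> h - \<mu> k) /\<^sub>R (h - k)) \<longlongrightarrow> \<mu>' k) (at k)"
    proof (rule Lim_transform_eventually)
      have "eventually (\<lambda>h. h \<in> {-\<epsilon><..<\<epsilon>}) (at k)"
        using k by (intro eventually_at_in_open') auto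
      then show "eventually (\<lambda>h. - (((?q (\<mu> k) h - ?q (\<mu> k) k) /\<^sub>R (h - k)) / ?Q (\<mu> h) (\<mu> k) h)
          = (\<mu> h - \<mu> k) /\<^sub>R (h - k)) (at k)"
      proof eventually_elim
        case (elim h)
        then have h: "\<bar>h\<bar> < \<epsilon>" by auto
        show ?case unfolding diff[OF h k] scaleR_conv_of_real divide_inverse
          by (simp only: mult_minus_right mult.assoc)
      qed
    qed
    then show ?thesis by (simp only: has_vector_derivative_iff_slope)
  qed
  have "ck_on n {-\<epsilon><..<\<epsilon>} \<mu>" for n
  proof (induction n)
    case 0
    show ?case using cont by (auto intro!: continuous_at_imp_continuous_on)
  next
    case (Suc n)
    have "ck_on n {-\<epsilon><..<\<epsilon>} \<mu>'"
      unfolding \<mu>'_def divdiff_def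
    proof (intro ck_on_uminus ck_on_divide ck_on_sum ck_on_mult ck_on_power cka Suc, fold divdiff_def)
      fix t assume "t \<in> {-\<epsilon><..<\<epsilon>}"
      then have "\<bar>t\<bar> < \<epsilon>" by auto
      from Q\<mu>[OF this this] c show "?Q (\<mu> t) (\<mu> t) t \<noteq> 0" by auto
    qed
    with d\<mu> show ?case by (rule ck_on_SucI)
  qed
  then have "smooth_on {-\<epsilon><..<\<epsilon>} \<mu>" by (simp add: smooth_on_def)
  then show ?thesis
    using \<epsilon>(1,2) \<mu>0 \<mu> by (intro that) blast+
qed

section \<open>Characteristic polynomials and diagonalizable matrices\<close>

definition diag_mat :: "('n \<Rightarrow> 'a::zero) \<Rightarrow> 'a ^ 'n ^ 'n" where
  "diag_mat d = (\<chi> i j. if i = j then d i else 0)"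

lemma diag_mat_nth: "diag_mat d $ i $ j = (if i = j then d i else 0)"
  by (simp add: diag_mat_def)

lemma matrix_mult_diag_nth:
  fixes A :: "'a::semiring_1 ^ 'n ^ 'n"
  shows "(A ** diag_mat d) $ i $ j = A $ i $ j * d j"
  by (simp add: matrix_matrix_mult_def diag_mat_nth if_distrib cong: if_cong)

lemma diag_mult_diag:
  fixes d e :: "'n::finite \<Rightarrow> 'a::semiring_1"
  shows "diag_mat d ** diag_mat e = diag_mat (\<lambda>i. d i * e i)"
  by (auto simp: vec_eq_iff matrix_mult_diag_nth diag_mat_nth)

lemma det_diag_mat:
  fixes d :: "'n::finite \<Rightarrow> 'a::comm_ring_1"
  shows "det (diag_mat d) = (\<Prod>i\<in>UNIV. d i)"
  using det_diagonal[of "diag_mat d"] by (simp add: diag_mat_nth)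

lemma mat_minus_mult_vec:
  fixes A :: "'a::comm_ring_1 ^ 'n ^ 'n"
  shows "(mat z - A) *v v = z *s v - A *v v"
  by (simp add: vec_eq_iff matrix_vector_mult_def mat_def left_diff_distrib sum_subtractf
      if_distrib[of "\<lambda>x. x * _"] cong: if_cong)

lemma invertible_matrix_inv:
  fixes A :: "'a::semiring_1 ^ 'n ^ 'n"
  assumes "invertible A"
  shows "A ** matrix_inv A = mat 1" "matrix_inv A ** A = mat 1"
  using someI_ex[OF assms[unfolded invertible_def]] by (auto simp: matrix_inv_def)

lemma matrix_mult_diff_mult:
  fixes A :: "'a::ring_1 ^ 'n ^ 'n"
  shows "A ** (X - Y) ** C = A ** X ** C - A ** Y ** C"
  by (simp add: vec_eq_iff matrix_matrix_mult_def right_diff_distrib left_diff_distrib sum_subtractf)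

lemma matrix_add_scaleR_mult:
  fixes A :: "'a::real_algebra_1 ^ 'n ^ 'n"
  shows "(A + c *\<^sub>R B) ** C = A ** C + c *\<^sub>R (B ** C)"
  by (simp add: vec_eq_iff matrix_matrix_mult_def distrib_right sum.distrib scaleR_sum_right)

lemma scaleR_matrix_nth: "(c *\<^sub>R A) $ a $ b = of_real c * A $ a $ b"
  for A :: "complex ^ 'n ^ 'm"
  by (simp only: vector_scaleR_component) (simp add: scaleR_conv_of_real)

lemma det_zero_iff_kernel:
  fixes A :: "'a::field ^ 'n ^ 'n"
  shows "det A = 0 \<longleftrightarrow> (\<exists>v. v \<noteq> 0 \<and> A *v v = 0)"
  using matrix_left_invertible_ker[of A] invertible_det_nz[of A] invertible_left_inverse[of A] by auto

lemma eigenvalue_iff_det: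
  fixes A :: "'a::field ^ 'n ^ 'n"
  shows "c \<in> eigenvalues A \<longleftrightarrow> det (mat c - A) = 0"
  unfolding det_zero_iff_kernel eigenvalues_def mat_minus_mult_vec by auto

lemma poly_charpoly:
  fixes A :: "'a::comm_ring_1 ^ 'n ^ 'n"
  shows "poly (charpoly A) z = det (mat z - A)"
  unfolding charpoly_def det_def
  by (simp add: poly_sum poly_prod map_matrix_def mat_def if_distrib[of "\<lambda>p. poly p z"] of_int_poly
        cong: if_cong)

text \<open>In the Leibniz formula only the identity permutation contributes degree \<open>n\<close>: any other one picks
  at least one off-diagonal, hence constant, entry.\<close>

lemma coeff_charpoly_above:
  fixes A :: "'a::idom ^ 'n ^ 'n"
  assumes "k \<ge> CARD('n)"
  shows "coeff (charpoly A) k = (if k = CARD('n) then 1 else 0)"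
proof -
  let ?M = "mat [:0, 1:] - map_matrix (\<lambda>a. [:a:]) A"
  have M: "?M $ i $ j = (if i = j then [:- (A $ i $ j), 1:] else [:- (A $ i $ j):])" for i j
    by (simp add: mat_def map_matrix_def)
  have deg: "degree (?M $ i $ j) = (if i = j then 1 else 0)" for i j
    unfolding M by simp
  have other: "coeff (of_int (sign q) * (\<Prod>i\<in>UNIV. ?M $ i $ q i)) k = 0"
    if q: "q permutes UNIV" "q \<noteq> id" for q :: "'n \<Rightarrow> 'n"
  proof (rule coeff_eq_0)
    obtain a where a: "q a \<noteq> a" using q(2) by (auto simp: fun_eq_iff)
    have "degree (of_int (sign q) * (\<Prod>i\<in>UNIV. ?M $ i $ q i)) \<le> degree (\<Prod>i\<in>UNIV. ?M $ i $ q i)"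
      by (rule order_trans[OF degree_mult_le]) simp
    also have "\<dots> \<le> (\<Sum>i\<in>UNIV. degree (?M $ i $ q i))"
      using degree_prod_sum_le[of UNIV "\<lambda>i. ?M $ i $ q i"] by (simp add: o_def)
    also have "\<dots> < (\<Sum>i\<in>(UNIV :: 'n set). 1)"
      unfolding deg by (rule sum_strict_mono_ex1) (use not_sym[OF a] in auto)
    finally show "degree (of_int (sign q) * (\<Prod>i\<in>UNIV. ?M $ i $ q i)) < k"
      using assms by simp
  qed
  have "degree (\<Prod>i\<in>UNIV. [:- (A $ i $ i), 1:]) = CARD('n)"
    by (subst degree_prod_sum_eq) auto
  moreover have "lead_coeff (\<Prod>i\<in>UNIV. [:- (A $ i $ i), 1:]) = 1"
    by (simp add: lead_coeff_prod)
  ultimately have id: "coeff (\<Prod>i\<in>UNIV. [:- (A $ i $ i), 1:]) k = (if k = CARD('n) then 1 else 0)"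
    using assms by (auto intro: coeff_eq_0)
  have "coeff (charpoly A) k = (\<Sum>q | q permutes UNIV. coeff (of_int (sign q) * (\<Prod>i\<in>UNIV. ?M $ i $ q i)) k)"
    by (simp add: charpoly_def det_def coeff_sum)
  also have "\<dots> = (\<Sum>q\<in>{id}. coeff (of_int (sign q) * (\<Prod>i\<in>UNIV. ?M $ i $ q i)) k)"
  proof (rule sum.mono_neutral_right)
    show "\<forall>q\<in>{q. q permutes UNIV} - {id}. coeff (of_int (sign q) * (\<Prod>i\<in>UNIV. ?M $ i $ q i)) k = 0"
      using other by blast
  qed (simp_all add: permutes_id finite_permutations)
  also have "\<dots> = (if k = CARD('n) then 1 else 0)"
    unfolding M using id by simp
  finally show ?thesis .
qed

lemma degree_charpoly:
  fixes A :: "'a::idom ^ 'n ^ 'n"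
  shows "degree (charpoly A) = CARD('n)"
  by (intro antisym degree_le le_degree) (auto simp: coeff_charpoly_above)

lemma poly_charpoly_sum:
  fixes A :: "'a::idom ^ 'n ^ 'n"
  shows "(\<Sum>k\<le>CARD('n). coeff (charpoly A) k * z ^ k) = det (mat z - A)"
  using poly_altdef[of "charpoly A" z] by (simp add: degree_charpoly poly_charpoly)

text \<open>The multiplicities of the roots of the characteristic polynomial add up to its degree.\<close>

lemma card_simple_eigenvalues:
  fixes A :: "complex ^ 'n ^ 'n"
  assumes "\<And>c. c \<in> eigenvalues A \<Longrightarrow> simple_eigenvalue A c"
  shows "card (eigenvalues A) = CARD('n)"
proof -
  let ?p = "charpoly A"
  have nz: "?p \<noteq> 0" using degree_charpoly[of A] by auto
  have roots: "eigenvalues A = {z. poly ?p z = 0}"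
    by (auto simp: eigenvalue_iff_det poly_charpoly)
  have "CARD('n) = size (proots ?p)"
    by (simp add: size_proots_complex degree_charpoly)
  also have "\<dots> = (\<Sum>z\<in>eigenvalues A. order z ?p)"
    unfolding size_multiset_overloaded_eq using nz by (simp add: roots)
  also have "\<dots> = (\<Sum>z\<in>eigenvalues A. 1)"
    by (rule sum.cong) (use assms in \<open>auto simp: simple_eigenvalue_def\<close>)
  finally show ?thesis by simp
qed

text \<open>Applying \<open>A - l a\<close> to a linear relation removes the term of index \<open>a\<close> and multiplies the others
  by the nonzero factors \<open>l j - l a\<close>, which gives a shorter relation.\<close>

lemma eigenvectors_independent:
  fixes A :: "'a::field ^ 'n ^ 'n"
  assumes "finite J" "inj_on l J"
    and "\<And>j. j \<in> J \<Longrightarrow> A *v v j = l j *s v j" "\<And>j. j \<in> J \<Longrightarrow> v j \<noteq> 0"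
    and "(\<Sum>j\<in>J. x j *s v j) = 0"
  shows "\<forall>j\<in>J. x j = 0"
  using assms
proof (induction J arbitrary: x rule: finite_induct)
  case (insert a J)
  have sum0: "x a *s v a + (\<Sum>j\<in>J. x j *s v j) = 0"
    using insert.prems(4) insert.hyps by simp
  have "A *v (x a *s v a + (\<Sum>j\<in>J. x j *s v j)) =
        x a *s (l a *s v a) + (\<Sum>j\<in>J. x j *s (l j *s v j))"
    using insert.prems(2)
    by (simp add: matrix_vector_right_distrib vec.scale vec.sum)
  then have "x a *s (l a *s v a) + (\<Sum>j\<in>J. x j *s (l j *s v j)) = 0"
    unfolding sum0 by simp
  then have 1: "(\<Sum>j\<in>J. x j *s (l j *s v j)) = - (x a *s (l a *s v a))"
    by (simp only: add_eq_0_iff)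
  have "l a *s (x a *s v a) + (\<Sum>j\<in>J. l a *s (x j *s v j)) = 0"
    using arg_cong[OF sum0, of "\<lambda>u. l a *s u"]
    by (simp add: vec.scale_right_distrib vec.scale_sum_right)
  then have 2: "(\<Sum>j\<in>J. l a *s (x j *s v j)) = - (x a *s (l a *s v a))"
    by (simp only: add_eq_0_iff vector_smult_assoc mult.commute)
  have "(\<Sum>j\<in>J. (x j * (l j - l a)) *s v j) = (\<Sum>j\<in>J. x j *s (l j *s v j)) - (\<Sum>j\<in>J. l a *s (x j *s v j))"
    unfolding sum_subtractf[symmetric]
    by (rule sum.cong) (auto simp: vec_eq_iff algebra_simps)
  then have "(\<Sum>j\<in>J. (x j * (l j - l a)) *s v j) = 0"
    by (simp only: 1 2 diff_self)
  then have "\<forall>j\<in>J. x j * (l j - l a) = 0"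
    using insert.prems by (intro insert.IH) auto
  moreover have "l j \<noteq> l a" if "j \<in> J" for j
    using insert.prems(1) insert.hyps(2) that by (auto simp: inj_on_def)
  ultimately have J: "\<forall>j\<in>J. x j = 0" by auto
  then have "x a *s v a = 0" using sum0 by simp
  then show ?case using J insert.prems(3) by (simp add: vec.scale_eq_0_iff)
qed simp

lemma diagonalization_of_distinct:
  fixes A :: "'a::field ^ 'n ^ 'n"
  assumes "card (eigenvalues A) = CARD('n)"
  obtains V :: "'a ^ 'n ^ 'n" and l where "invertible V" "inj l" "range l = eigenvalues A" "A ** V = V ** diag_mat l"
proof -
  have "finite (eigenvalues A)" using assms by (metis card.infinite zero_less_card_finite less_irrefl)
  then obtain l :: "'n \<Rightarrow> 'a" where l: "bij_betw l UNIV (eigenvalues A)"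
    using assms by (metis finite_class.finite_UNIV finite_same_card_bij)
  have "\<forall>i. \<exists>v. v \<noteq> 0 \<and> A *v v = l i *s v"
    using l by (fastforce simp: eigenvalues_def bij_betw_def)
  then obtain v where v: "\<And>i. v i \<noteq> 0" "\<And>i. A *v v i = l i *s v i" by metis
  define V where "V = (\<chi> a i. v i $ a)"
  have Vx: "V *v x = (\<Sum>j\<in>UNIV. x $ j *s v j)" for x
    by (simp add: vec_eq_iff V_def matrix_vector_mult_def mult.commute)
  have inj: "inj l" using l by (simp add: bij_betw_def)
  have "invertible V"
    unfolding invertible_left_inverse matrix_left_invertible_ker
  proof (intro allI impI)
    fix x assume "V *v x = 0"
    then have "\<forall>j\<in>UNIV. x $ j = 0"
      using inj v by (intro eigenvectors_independent[of UNIV l A v]) (auto simp: Vx)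
    then show "x = 0" by (simp add: vec_eq_iff)
  qed
  moreover have "A ** V = V ** diag_mat l"
    using v(2) by (simp add: vec_eq_iff matrix_mult_diag_nth)
       (simp add: V_def matrix_matrix_mult_def matrix_vector_mult_def mult.commute)
  ultimately show ?thesis
    using l inj by (intro that[of V l]) (auto simp: bij_betw_def)
qed

lemma eigenvalues_diagonalizable:
  fixes V W :: "'a::field ^ 'n ^ 'n"
  assumes "V ** W = mat 1"
  shows "eigenvalues (V ** diag_mat d ** W) = range d"
proof -
  have "c \<in> eigenvalues (V ** diag_mat d ** W) \<longleftrightarrow> c \<in> range d" for c
  proof -
    have "mat c = V ** diag_mat (\<lambda>_. c) ** W"
    proof -
      have "V ** diag_mat (\<lambda>_. c) = (\<chi> i j. c * V $ i $ j)"
        by (simp add: vec_eq_iff matrix_mult_diag_nth mult.commute)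
      then have "V ** diag_mat (\<lambda>_. c) ** W = (\<chi> i j. c * (V ** W) $ i $ j)"
        by (simp add: vec_eq_iff matrix_matrix_mult_def sum_distrib_left mult.assoc)
      then show ?thesis by (simp add: assms vec_eq_iff mat_def)
    qed
    then have "mat c - V ** diag_mat d ** W = V ** diag_mat (\<lambda>i. c - d i) ** W"
      by (simp add: vec_eq_iff matrix_mult_diag_nth matrix_matrix_mult_def[of _ W]
          sum_subtractf[symmetric] algebra_simps)
    then have "det (mat c - V ** diag_mat d ** W) = det (V ** W) * (\<Prod>i\<in>UNIV. c - d i)"
      by (simp add: det_mul det_diag_mat mult.commute)
    then show ?thesis
      by (auto simp: eigenvalue_iff_det assms)
  qed
  then show ?thesis by blast
qed

lemma sums_vec:
  fixes f :: "nat \<Rightarrow> 'a::real_normed_vector ^ 'n"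
  assumes "\<And>i. (\<lambda>k. f k $ i) sums (s $ i)"
  shows "f sums s"
  using assms unfolding sums_def by (intro vec_tendstoI) simp

lemma matrix_exp_diagonalizable:
  fixes V W :: "complex ^ 'n ^ 'n"
  assumes "W ** V = mat 1"
  shows "matrix_exp (V ** diag_mat d ** W) = V ** diag_mat (\<lambda>i. exp (d i)) ** W"
proof -
  let ?A = "V ** diag_mat d ** W"
  have VW: "V ** W = mat 1" using assms by (simp add: matrix_left_right_inverse)
  have pow: "((**) ?A ^^ k) (mat 1) = V ** diag_mat (\<lambda>i. d i ^ k) ** W" for k
  proof (induction k)
    case 0
    have "(diag_mat (\<lambda>i. 1) :: complex ^ 'n ^ 'n) = mat 1" by (simp add: diag_mat_def mat_def)
    then show ?case by (simp add: VW)
  next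
    case (Suc k)
    have "((**) ?A ^^ Suc k) (mat 1) = V ** diag_mat d ** (W ** V) ** diag_mat (\<lambda>i. d i ^ k) ** W"
      by (simp add: Suc matrix_mul_assoc)
    also have "\<dots> = V ** (diag_mat d ** diag_mat (\<lambda>i. d i ^ k)) ** W"
      by (simp add: assms matrix_mul_assoc)
    finally show ?case by (simp add: diag_mult_diag)
  qed
  have entry: "(V ** diag_mat x ** W) $ i $ j = (\<Sum>m\<in>UNIV. V $ i $ m * x m * W $ m $ j)" for x i j
    by (simp add: matrix_matrix_mult_def[of _ W] matrix_mult_diag_nth)
  have "(\<lambda>k. (1 / fact k) *\<^sub>R ((**) ?A ^^ k) (mat 1)) sums (V ** diag_mat (\<lambda>i. exp (d i)) ** W)"
  proof (intro sums_vec)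
    fix i j
    have "(\<lambda>k. \<Sum>m\<in>UNIV. V $ i $ m * (d m ^ k /\<^sub>R fact k) * W $ m $ j) sums
          (\<Sum>m\<in>UNIV. V $ i $ m * exp (d m) * W $ m $ j)"
      by (intro sums_sum sums_mult sums_mult2 exp_converges)
    then show "(\<lambda>k. ((1 / fact k) *\<^sub>R ((**) ?A ^^ k) (mat 1)) $ i $ j) sums
          (V ** diag_mat (\<lambda>i. exp (d i)) ** W) $ i $ j"
      by (simp add: pow entry scaleR_sum_right divide_inverse)
  qed
  then show ?thesis by (simp add: matrix_exp_def sums_unique[symmetric])
qed

section \<open>Smooth diagonalization near a diagonal matrix with distinct entries\<close>

lemma ck_on_det:
  fixes A :: "real \<Rightarrow> complex ^ 'n ^ 'n"
  assumes "\<And>i j. ck_on n U (\<lambda>t. A t $ i $ j)"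
  shows "ck_on n U (\<lambda>t. det (A t))"
  unfolding det_def by (intro ck_on_sum ck_on_mult ck_on_const ck_on_prod assms)

lemma ck_on_coeff_prod:
  fixes f :: "'i \<Rightarrow> real \<Rightarrow> complex poly"
  assumes "\<And>i k. ck_on n U (\<lambda>t. coeff (f i t) k)"
  shows "ck_on n U (\<lambda>t. coeff (\<Prod>i\<in>I. f i t) k)"
proof (induction I arbitrary: k rule: infinite_finite_induct)
  case (insert a I)
  then show ?case
    by (simp add: coeff_mult) (intro ck_on_sum ck_on_mult assms insert.IH)
qed (auto intro: ck_on_const)

text \<open>Differentiability of all coefficients is inherited by sums and products of polynomials, hence by a
  determinant over the polynomial ring.\<close>

lemma ck_on_coeff_charpoly:
  fixes A :: "real \<Rightarrow> complex ^ 'n ^ 'n"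
  assumes "\<And>i j. ck_on n U (\<lambda>t. A t $ i $ j)"
  shows "ck_on n U (\<lambda>t. coeff (charpoly (A t)) k)"
proof -
  let ?M = "\<lambda>t. mat [:0, 1:] - map_matrix (\<lambda>a. [:a:]) (A t)"
  have M: "coeff (?M t $ i $ j) k = coeff (if i = j then [:0, 1:] else 0) k - (if k = 0 then A t $ i $ j else 0)"
    for t i j k
    by (simp add: mat_def map_matrix_def coeff_pCons split: nat.split)
  have "ck_on n U (\<lambda>t. coeff (?M t $ i $ j) k)" for i j k
    unfolding M by (cases "k = 0") (auto intro!: ck_on_diff ck_on_uminus ck_on_const assms)
  then have "ck_on n U (\<lambda>t. coeff (of_int (sign q) * (\<Prod>i\<in>UNIV. ?M t $ i $ q i)) k)" for q :: "'n \<Rightarrow> 'n"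
    unfolding coeff_mult by (intro ck_on_sum ck_on_mult ck_on_const ck_on_coeff_prod)
  then show ?thesis
    unfolding charpoly_def det_def coeff_sum by (intro ck_on_sum)
qed

text \<open>The value is \<open>\<Prod>j\<noteq>i. l i - l j\<close>: away from \<open>l i\<close> the divided difference is the cofactor of the
  root \<open>l i\<close> in \<open>\<Prod>j. z - l j\<close>, and both sides are continuous.\<close>

lemma divdiff_charpoly_diag:
  fixes l :: "'n::finite \<Rightarrow> complex"
  assumes "inj l"
  shows "divdiff CARD('n) (coeff (charpoly (diag_mat l))) (l i) (l i) \<noteq> 0"
proof -
  let ?d = "\<lambda>z. divdiff CARD('n) (coeff (charpoly (diag_mat l))) z (l i)"
  let ?R = "\<lambda>z. \<Prod>j\<in>UNIV - {i}. z - l j"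
  have q: "(\<Sum>k\<le>CARD('n). coeff (charpoly (diag_mat l)) k * z ^ k) = (z - l i) * ?R z" for z
  proof -
    have "mat z - diag_mat l = diag_mat (\<lambda>j. z - l j)"
      by (simp add: vec_eq_iff mat_def diag_mat_nth)
    then show ?thesis
      by (simp add: poly_charpoly_sum det_diag_mat prod.remove[of UNIV i])
  qed
  have eq: "?d z = ?R z" if "z \<noteq> l i" for z
    using divdiff_eq[of "coeff (charpoly (diag_mat l))" z "CARD('n)" "l i"] that by (simp add: q)
  have "isCont ?d (l i)" unfolding divdiff_def by (intro continuous_intros)
  then have 1: "(?d \<longlongrightarrow> ?d (l i)) (at (l i))" by (simp add: isCont_def)
  have "isCont ?R (l i)" by (intro continuous_intros)
  then have "(?R \<longlongrightarrow> ?R (l i)) (at (l i))" by (simp add: isCont_def)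
  then have "(?d \<longlongrightarrow> ?R (l i)) (at (l i))"
    by (rule Lim_transform_eventually) (simp add: eventually_at_filter eq)
  with 1 have "?d (l i) = ?R (l i)" by (rule LIM_unique)
  then show ?thesis using assms by (auto simp: prod_zero_iff inj_eq)
qed

lemma nonzero_near_0:
  fixes f :: "real \<Rightarrow> complex"
  assumes "continuous_on {-e<..<e} f" "0 < e" "f 0 \<noteq> 0"
  obtains d where "0 < d" "d \<le> e" "\<And>h. \<bar>h\<bar> < d \<Longrightarrow> f h \<noteq> 0"
proof -
  have "isCont f 0" using assms by (simp add: continuous_on_eq_continuous_at)
  then have "eventually (\<lambda>h. f h \<noteq> 0) (nhds 0)"
    by (intro tendsto_imp_eventually_ne[OF isCont_imp_tendsto_nhds] assms)
  then obtain d where "d > 0" "\<And>h. \<bar>h\<bar> < d \<Longrightarrow> f h \<noteq> 0"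
    by (auto simp: eventually_nhds_metric dist_real_def)
  then show ?thesis using assms(2) by (intro that[of "min d e"]) auto
qed

text \<open>The eigenvalues are provided by \<open>smooth_simple_root\<close>. For the eigenvector belonging to \<open>\<mu>\<^sub>i\<close>,
  replace row \<open>i\<close> of \<open>B - \<mu>\<^sub>i\<close> by the equation \<open>v\<^sub>i = 1\<close>. At \<open>h = 0\<close> the resulting matrix \<open>M\<^sub>i\<close> is
  diagonal with nonzero entries, so near \<open>0\<close> the system \<open>M\<^sub>i v = e\<^sub>i\<close> has a unique solution, smooth by
  Cramer's rule. The discarded equation holds automatically: an eigenvector \<open>u\<close> exists and satisfies
  \<open>M\<^sub>i u = u\<^sub>i e\<^sub>i\<close>, so \<open>u = u\<^sub>i v\<close> with \<open>u\<^sub>i \<noteq> 0\<close>.\<close>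

lemma smooth_diagonalization:
  fixes B :: "real \<Rightarrow> complex ^ 'n ^ 'n"
  assumes r: "r > 0" and smooth: "\<And>i j. smooth_on {-r<..<r} (\<lambda>h. B h $ i $ j)"
    and B0: "B 0 = diag_mat l" and l: "inj l"
  obtains \<epsilon> \<mu> W where "0 < \<epsilon>" "\<epsilon> \<le> r" "\<And>i. smooth_on {-\<epsilon><..<\<epsilon>} (\<mu> i)" "\<And>i. \<mu> i 0 = l i"
    "\<And>i j. smooth_on {-\<epsilon><..<\<epsilon>} (\<lambda>h. (W h :: complex ^ 'n ^ 'n) $ i $ j)" "W 0 = mat 1"
    "\<And>h. \<bar>h\<bar> < \<epsilon> \<Longrightarrow> invertible (W h)" "\<And>h i. \<bar>h\<bar> < \<epsilon> \<Longrightarrow> W h $ i $ i = 1"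
    "\<And>h. \<bar>h\<bar> < \<epsilon> \<Longrightarrow> B h ** W h = W h ** diag_mat (\<lambda>i. \<mu> i h)"
proof -
  have "\<exists>e m. 0 < e \<and> e \<le> r \<and> smooth_on {-e<..<e} m \<and> m 0 = l i \<and>
          (\<forall>h. \<bar>h\<bar> < e \<longrightarrow> det (mat (m h) - B h) = 0)" for i
  proof -
    have sm: "smooth_on {-r<..<r} (\<lambda>h. coeff (charpoly (B h)) k)" for k
      using smooth by (auto simp: smooth_on_def intro: ck_on_coeff_charpoly)
    have rt: "(\<Sum>k\<le>CARD('n). coeff (charpoly (B 0)) k * l i ^ k) = 0"
    proof -
      have "l i \<in> eigenvalues (mat 1 ** diag_mat l ** mat 1)"
        by (subst eigenvalues_diagonalizable) auto
      then show ?thesis by (simp add: poly_charpoly_sum eigenvalue_iff_det B0)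
    qed
    have mon: "coeff (charpoly (B h)) CARD('n) = 1" for h
      by (simp add: coeff_charpoly_above)
    have simp: "divdiff CARD('n) (coeff (charpoly (B 0))) (l i) (l i) \<noteq> 0"
      unfolding B0 by (rule divdiff_charpoly_diag[OF l])
    show ?thesis
      by (rule smooth_simple_root[where a="\<lambda>k h. coeff (charpoly (B h)) k", OF r sm mon rt simp])
         (auto simp: poly_charpoly_sum)
  qed
  then obtain e \<mu> where e: "\<And>i. 0 < e i" "\<And>i. e i \<le> r" and \<mu>: "\<And>i. smooth_on {-e i<..<e i} (\<mu> i)"
    "\<And>i. \<mu> i 0 = l i" "\<And>i h. \<bar>h\<bar> < e i \<Longrightarrow> det (mat (\<mu> i h) - B h) = 0"
    by metis
  define e0 where "e0 = Min (range e)"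
  have e0: "0 < e0" "e0 \<le> e i" for i
    using e by (auto simp: e0_def)
  have e0r: "e0 \<le> r" using e0(2) e(2) order_trans by blast
  \<comment> \<open>Row \<open>i\<close> of \<open>B h - \<mu> i h\<close> is replaced by the unit row.\<close>
  define M where "M i h = (\<chi> a b. if a = i then (if b = i then 1 else 0)
    else B h $ a $ b - (if a = b then \<mu> i h else 0))" for i h
  have ck\<mu>: "ck_on n {-e0<..<e0} (\<mu> i)" for n i
    using \<mu>(1)[of i] e0(2)[of i] by (auto simp: smooth_on_def intro: ck_on_subset[of _ "{-e i<..<e i}"])
  have ckB: "ck_on n {-e0<..<e0} (\<lambda>h. B h $ a $ b)" for n a b
    using smooth[of a b] e0r by (auto simp: smooth_on_def intro: ck_on_subset[of _ "{-r<..<r}"])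
  have ckM: "ck_on n {-e0<..<e0} (\<lambda>h. M i h $ a $ b)" for n i a b
  proof (cases "a = i")
    case True
    then show ?thesis by (simp add: M_def ck_on_const)
  next
    case False
    then show ?thesis by (cases "a = b") (auto simp: M_def intro!: ck_on_diff ckB ck\<mu> ck_on_const)
  qed
  have M0: "M i 0 = diag_mat (\<lambda>a. if a = i then 1 else l a - l i)" for i
    by (auto simp: M_def B0 diag_mat_nth vec_eq_iff \<mu>(2))
  have ckd: "ck_on n {-e0<..<e0} (\<lambda>h. det (M i h))" for n i
    by (intro ck_on_det ckM)
  have "continuous_on {-e0<..<e0} (\<lambda>h. \<Prod>i\<in>UNIV. det (M i h))"
    by (intro ck_on_imp_continuous ck_on_prod ckd)
  moreover have "(\<Prod>i\<in>UNIV. det (M i 0)) \<noteq> 0"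
    using l by (auto simp: M0 det_diag_mat inj_eq)
  ultimately obtain e1 where e1: "0 < e1" "e1 \<le> e0" "\<And>h. \<bar>h\<bar> < e1 \<Longrightarrow> (\<Prod>i\<in>UNIV. det (M i h)) \<noteq> 0"
    using nonzero_near_0[of e0 "\<lambda>h. \<Prod>i\<in>UNIV. det (M i h)"] e0(1) by metis
  have dM: "det (M i h) \<noteq> 0" if "\<bar>h\<bar> < e1" for i h
    using e1(3)[OF that] by simp
  define v where "v i h = (\<chi> k. det (\<chi> a b. if b = k then axis i 1 $ a else M i h $ a $ b) / det (M i h))" for i h
  have Mv: "M i h *v v i h = axis i 1" if "\<bar>h\<bar> < e1" for i h
    using cramer[OF dM[OF that], of i "v i h" "axis i 1"] by (simp add: v_def)
  have ker: "x = 0" if "M i h *v x = 0" "\<bar>h\<bar> < e1" for i h x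
    using dM[OF that(2), of i] that(1) det_zero_iff_kernel[of "M i h"] by auto
  have Mx: "(M i h *v x) $ a = (if a = i then x $ i else (B h *v x) $ a - \<mu> i h * x $ a)" for i h x a
    by (simp add: M_def matrix_vector_mult_def left_diff_distrib sum_subtractf
        if_distrib[of "\<lambda>u. u * _"] cong: if_cong)
  have vi: "v i h $ i = 1" if "\<bar>h\<bar> < e1" for i h
    using arg_cong[OF Mv[OF that, of i], of "\<lambda>u. u $ i"] by (simp add: Mx axis_def)
  have Bv: "B h *v v i h = \<mu> i h *s v i h" if h: "\<bar>h\<bar> < e1" for i h
  proof -
    have "det (mat (\<mu> i h) - B h) = 0" using \<mu>(3) e1(2) e0(2)[of i] h by auto
    then obtain u where u: "u \<noteq> 0" "B h *v u = \<mu> i h *s u"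
      by (auto simp: det_zero_iff_kernel mat_minus_mult_vec)
    \<comment> \<open>Any eigenvector \<open>u\<close> solves the modified system up to the factor \<open>u $ i\<close>.\<close>
    have "M i h *v u = u $ i *s axis i 1"
      by (auto simp: vec_eq_iff Mx u(2) axis_def)
    then have "M i h *v (u - u $ i *s v i h) = 0"
      by (simp add: matrix_vector_mult_diff_distrib vec.scale Mv[OF h])
    then have uv: "u = u $ i *s v i h"
      using ker[OF _ h] by fastforce
    then have ui: "u $ i \<noteq> 0" using u(1) by auto
    have "u $ i *s (B h *v v i h) = u $ i *s (\<mu> i h *s v i h)"
      using u(2) uv by (metis vec.scale vector_smult_assoc mult.commute)
    then show ?thesis using ui by (simp add: vec_eq_iff)
  qed
  define W where "W h = (\<chi> a i. v i h $ a)" for h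
  have ckW: "ck_on n {-e1<..<e1} (\<lambda>h. W h $ a $ i)" for n a i
  proof -
    have sub: "{-e1<..<e1} \<subseteq> {-e0<..<e0}" using e1 by auto
    have "ck_on n {-e1<..<e1} (\<lambda>h. (\<chi> c b. if b = a then axis i 1 $ c else M i h $ c $ b) $ c $ b)" for c b
      by (cases "b = a") (auto intro: ck_on_const ck_on_subset[OF ckM sub])
    then show ?thesis
      unfolding W_def v_def vec_lambda_beta
      by (intro ck_on_divide ck_on_det ck_on_subset[OF ckd sub]) (auto simp: dM)
  qed
  have W0: "W 0 = mat 1"
  proof -
    have "v i 0 = axis i 1" for i
    proof -
      have "M i 0 *v axis i 1 = axis i 1"
        by (auto simp: M0 vec_eq_iff matrix_vector_mult_def diag_mat_nth axis_def
            if_distrib[of "\<lambda>u. u * _"] cong: if_cong)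
      then have "M i 0 *v (v i 0 - axis i 1) = 0"
        using Mv[of 0 i] e1(1) by (simp add: matrix_vector_mult_diff_distrib)
      then show ?thesis using ker[of i 0] e1(1) by fastforce
    qed
    then show ?thesis by (simp add: W_def vec_eq_iff mat_def axis_def)
  qed
  have "continuous_on {-e1<..<e1} (\<lambda>h. det (W h))"
    by (intro ck_on_imp_continuous ck_on_det ckW)
  then obtain \<epsilon> where \<epsilon>: "0 < \<epsilon>" "\<epsilon> \<le> e1" "\<And>h. \<bar>h\<bar> < \<epsilon> \<Longrightarrow> det (W h) \<noteq> 0"
    using nonzero_near_0[of e1 "\<lambda>h. det (W h)"] e1(1) by (metis W0 det_I zero_neq_one)
  show ?thesis
  proof (rule that[of \<epsilon> \<mu> W])
    show "0 < \<epsilon>" "\<epsilon> \<le> r" using \<epsilon> e1 e0r by auto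
    show "smooth_on {-\<epsilon><..<\<epsilon>} (\<mu> i)" for i
      using ck\<mu>[of _ i] \<epsilon>(2) e1(2) by (auto simp: smooth_on_def intro: ck_on_subset[of _ "{-e0<..<e0}"])
    show "smooth_on {-\<epsilon><..<\<epsilon>} (\<lambda>h. W h $ i $ j)" for i j
      using ckW[of _ i j] \<epsilon>(2) by (auto simp: smooth_on_def intro: ck_on_subset[of _ "{-e1<..<e1}"])
    show "B h ** W h = W h ** diag_mat (\<lambda>i. \<mu> i h)" if "\<bar>h\<bar> < \<epsilon>" for h
    proof -
      have "(B h ** W h) $ a $ i = (W h ** diag_mat (\<lambda>i. \<mu> i h)) $ a $ i" for a i
        using arg_cong[OF Bv[of h i], of "\<lambda>u. u $ a"] that \<epsilon>(2)
        unfolding matrix_mult_diag_nth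
        by (simp add: W_def matrix_matrix_mult_def matrix_vector_mult_def mult.commute)
      then show ?thesis by (simp add: vec_eq_iff)
    qed
  qed (use \<mu>(2) W0 \<epsilon> vi in \<open>auto simp: invertible_det_nz W_def\<close>)
qed

section \<open>Orders of approximation\<close>

lemma bigo_power_imp_tendsto_0:
  fixes f :: "real \<Rightarrow> complex"
  assumes "f \<in> O[at 0](\<lambda>h. of_real h ^ k)" "k \<ge> 1"
  shows "(f \<longlongrightarrow> 0) (at 0)"
proof -
  obtain c where "eventually (\<lambda>h. norm (f h) \<le> c * norm (of_real h ^ k :: complex)) (at 0)"
    using assms(1) by (elim landau_o.bigE)
  moreover have "((\<lambda>h::real. c * norm (of_real h ^ k :: complex)) \<longlongrightarrow> c * norm (of_real 0 ^ k :: complex)) (at 0)"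
    by (intro tendsto_intros)
  then have "((\<lambda>h::real. c * norm (of_real h ^ k :: complex)) \<longlongrightarrow> 0) (at 0)"
    using assms(2) by (simp add: zero_power)
  ultimately show ?thesis by (rule Lim_null_comparison)
qed

lemma bigo_mult_tendsto:
  fixes f g :: "real \<Rightarrow> complex"
  assumes "f \<in> O[at 0](u)" "(g \<longlongrightarrow> c) (at 0)"
  shows "(\<lambda>h. f h * g h) \<in> O[at 0](u)"
proof -
  have "g \<in> O[at 0](\<lambda>_. 1)" using assms(2) by (intro bigoI_tendsto[where c=c]) auto
  from landau_o.big.mult[OF assms(1) this] show ?thesis by simp
qed

lemma bigo_cmult: "f \<in> O[F](u) \<Longrightarrow> (\<lambda>h. c * f h) \<in> O[F](u)"
  for f :: "real \<Rightarrow> complex"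
  by (cases "c = 0") simp_all

lemma bigo_matrix_norm:
  fixes X :: "real \<Rightarrow> complex ^ 'n ^ 'n"
  assumes "\<And>a b. (\<lambda>h. X h $ a $ b) \<in> O[at 0](\<lambda>h. of_real h ^ k)"
  shows "(\<lambda>h. norm (X h)) \<in> O[at 0](\<lambda>h. h ^ k)"
proof -
  have entry: "(\<lambda>h. norm (X h $ a $ b)) \<in> O[at 0](\<lambda>h. h ^ k)" for a b
  proof -
    have "(\<lambda>h. norm (X h $ a $ b)) \<in> O[at 0](\<lambda>h. norm (of_real h ^ k :: complex))"
      using assms[of a b] by simp
    also have "(\<lambda>h. norm (of_real h ^ k :: complex)) \<in> O[at 0](\<lambda>h. h ^ k)"
      by (intro landau_o.bigI[of 1]) (auto simp: norm_power power_abs)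
    finally show ?thesis .
  qed
  have "norm (X h) \<le> (\<Sum>a\<in>UNIV. \<Sum>b\<in>UNIV. norm (X h $ a $ b))" for h
  proof -
    have "norm (X h) \<le> (\<Sum>a\<in>UNIV. norm (X h $ a))"
      unfolding norm_vec_def[of "X h"] by (rule L2_set_le_sum) simp
    also have "\<dots> \<le> (\<Sum>a\<in>UNIV. \<Sum>b\<in>UNIV. norm (X h $ a $ b))"
      by (intro sum_mono) (simp add: norm_vec_def L2_set_le_sum)
    finally show ?thesis .
  qed
  then have "(\<lambda>h. norm (X h)) \<in> O[at 0](\<lambda>h. \<Sum>a\<in>UNIV. \<Sum>b\<in>UNIV. norm (X h $ a $ b))"
    by (intro landau_o.bigI[of 1]) (auto simp: sum_nonneg)
  also have "(\<lambda>h. \<Sum>a\<in>UNIV. \<Sum>b\<in>UNIV. norm (X h $ a $ b)) \<in> O[at 0](\<lambda>h. h ^ k)"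
    by (intro big_sum_in_bigo entry)
  finally show ?thesis .
qed

text \<open>Entry \<open>(a, i)\<close> of \<open>B W = W diag \<mu>\<close> reads
  \<open>(\<mu>\<^sub>i - B\<^sub>a\<^sub>a) W\<^sub>a\<^sub>i = \<Sum>j\<noteq>a. B\<^sub>a\<^sub>j W\<^sub>j\<^sub>i\<close>, and its right-hand side has the order of the off-diagonal
  entries of \<open>B\<close>. If \<open>a \<noteq> i\<close>, the factor \<open>\<mu>\<^sub>i - B\<^sub>a\<^sub>a\<close> tends to \<open>l\<^sub>i - l\<^sub>a \<noteq> 0\<close> and can be divided
  off; if \<open>a = i\<close>, then \<open>W\<^sub>i\<^sub>i = 1\<close> and the equation estimates \<open>\<mu>\<^sub>i - B\<^sub>i\<^sub>i\<close>.\<close>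

lemma diagonalization_order:
  fixes B W :: "real \<Rightarrow> complex ^ 'n ^ 'n"
  assumes B: "\<And>a b. (\<lambda>h. B h $ a $ b - (if a = b then m a h else 0)) \<in> O[at 0](u)"
    and m: "\<And>a. ((\<lambda>h. B h $ a $ a) \<longlongrightarrow> l a) (at 0)" and l: "inj l"
    and \<mu>: "\<And>i. (\<mu> i \<longlongrightarrow> l i) (at 0)"
    and W: "\<And>a i. ((\<lambda>h. W h $ a $ i) \<longlongrightarrow> W0 a i) (at 0)"
    and diag: "eventually (\<lambda>h. B h ** W h = W h ** diag_mat (\<lambda>i. \<mu> i h) \<and> (\<forall>i. W h $ i $ i = 1)) (at 0)"
  shows "a \<noteq> i \<Longrightarrow> (\<lambda>h. W h $ a $ i) \<in> O[at 0](u)"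
    and "(\<lambda>h. \<mu> i h - m i h) \<in> O[at 0](u)"
proof -
  have off: "(\<lambda>h. B h $ a $ b) \<in> O[at 0](u)" if "a \<noteq> b" for a b
    using B[of a b] that by simp
  have sum: "(\<lambda>h. \<Sum>j\<in>UNIV - {a}. B h $ a $ j * W h $ j $ i) \<in> O[at 0](u)" for a i
    by (intro big_sum_in_bigo bigo_mult_tendsto[OF off W]) auto
  have row: "B h $ a $ a * W h $ a $ i + (\<Sum>j\<in>UNIV - {a}. B h $ a $ j * W h $ j $ i) = \<mu> i h * W h $ a $ i"
    if "B h ** W h = W h ** diag_mat (\<lambda>i. \<mu> i h)" for h a i
  proof -
    have "(B h ** W h) $ a $ i = \<mu> i h * W h $ a $ i"
      unfolding that matrix_mult_diag_nth by (simp add: mult.commute)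
    then show ?thesis
      by (simp add: matrix_matrix_mult_def sum.remove[of UNIV a])
  qed
  show "(\<lambda>h. W h $ a $ i) \<in> O[at 0](u)" if ai: "a \<noteq> i" for a i
  proof -
    have ne: "l i - l a \<noteq> 0" using l ai by (auto simp: inj_eq)
    have lim: "((\<lambda>h. \<mu> i h - B h $ a $ a) \<longlongrightarrow> l i - l a) (at 0)"
      by (intro tendsto_diff \<mu> m)
    have "(\<lambda>h. (\<Sum>j\<in>UNIV - {a}. B h $ a $ j * W h $ j $ i) * inverse (\<mu> i h - B h $ a $ a)) \<in> O[at 0](u)"
      by (rule bigo_mult_tendsto[OF sum tendsto_inverse[OF lim ne]])
    moreover have "eventually (\<lambda>h. W h $ a $ i =
        (\<Sum>j\<in>UNIV - {a}. B h $ a $ j * W h $ j $ i) * inverse (\<mu> i h - B h $ a $ a)) (at 0)"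
      using diag tendsto_imp_eventually_ne[OF lim ne]
    proof eventually_elim
      case (elim h)
      then have "(\<Sum>j\<in>UNIV - {a}. B h $ a $ j * W h $ j $ i) = W h $ a $ i * (\<mu> i h - B h $ a $ a)"
        using row[of h a i] by (simp add: algebra_simps)
      then show ?case using elim(2) by simp
    qed
    ultimately show ?thesis by (simp add: landau_o.big.in_cong)
  qed
  show "(\<lambda>h. \<mu> i h - m i h) \<in> O[at 0](u)" for i
  proof -
    have A: "(\<lambda>h. (B h $ i $ i - m i h) + (\<Sum>j\<in>UNIV - {i}. B h $ i $ j * W h $ j $ i)) \<in> O[at 0](u)"
      using B[of i i] sum[of i i] by (intro sum_in_bigo(1)) simp_all
    have ev: "eventually (\<lambda>h. \<mu> i h - m i h =
        (B h $ i $ i - m i h) + (\<Sum>j\<in>UNIV - {i}. B h $ i $ j * W h $ j $ i)) (at 0)"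
      using diag
    proof eventually_elim
      case (elim h)
      then show ?case using row[of h i i] by simp
    qed
    show ?thesis using A by (simp only: landau_o.big.in_cong[OF ev])
  qed
qed

lemma abs_diff_le_exp_diff:
  fixes a b :: real
  assumes "exp a \<ge> 1 / 2" "exp b \<ge> 1 / 2"
  shows "\<bar>a - b\<bar> \<le> 2 * \<bar>exp a - exp b\<bar>"
proof -
  have *: "x - y \<le> 2 * (exp x - exp y)" if "y \<le> x" "exp y \<ge> 1 / 2" for x y :: real
  proof -
    have "x - y \<le> exp (x - y) - 1" using exp_ge_add_one_self[of "x - y"] by linarith
    also have "\<dots> = 1 * (exp (x - y) - 1)" by simp
    also have "\<dots> \<le> (2 * exp y) * (exp (x - y) - 1)"
      using that by (intro mult_right_mono) auto
    also have "\<dots> = 2 * (exp x - exp y)"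
      by (simp add: algebra_simps flip: exp_add)
    finally show ?thesis .
  qed
  show ?thesis
  proof (cases "b \<le> a")
    case True
    then show ?thesis using *[of b a] assms by simp
  next
    case False
    then show ?thesis using *[of a b] assms by simp
  qed
qed

text \<open>The function \<open>d\<close> is the Hadamard quotient of \<open>Ln (1 + h \<mu> h)\<close>. For the order, the real
  exponential is expanding up to a constant where it is bounded below, so \<open>h (d h - l)\<close> is controlled by
  \<open>exp (h d h) - exp (h l) = h (\<mu> h - m h)\<close>. Nothing is known about the quotient at \<open>h = 0\<close> directly;
  its value \<open>l\<close> there is forced by continuity and the estimate.\<close>

lemma smooth_logarithm:
  fixes \<mu> m :: "real \<Rightarrow> complex"
  assumes \<epsilon>: "0 < \<epsilon>" and smooth: "smooth_on {-\<epsilon><..<\<epsilon>} \<mu>"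
    and real: "\<And>h. \<bar>h\<bar> < \<epsilon> \<Longrightarrow> \<mu> h \<in> \<real>"
    and pos: "\<And>h. \<bar>h\<bar> < \<epsilon> \<Longrightarrow> Re (1 + of_real h * \<mu> h) \<ge> 1 / 2"
    and l: "l \<in> \<real>" and m: "\<And>h. exp (of_real h * l) = 1 + of_real h * m h"
    and order: "(\<lambda>h. \<mu> h - m h) \<in> O[at 0](\<lambda>h. of_real h ^ p)" and p: "p \<ge> 1"
  obtains d where "smooth_on {-\<epsilon><..<\<epsilon>} d" "\<And>h. \<bar>h\<bar> < \<epsilon> \<Longrightarrow> d h \<in> \<real>"
    "\<And>h. \<bar>h\<bar> < \<epsilon> \<Longrightarrow> exp (of_real h * d h) = 1 + of_real h * \<mu> h"
    "d 0 = l" "(\<lambda>h. d h - l) \<in> O[at 0](\<lambda>h. of_real h ^ p)"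
proof -
  let ?f = "\<lambda>h. 1 + of_real h * \<mu> h"
  have npos: "?f h \<notin> \<real>\<^sub>\<le>\<^sub>0" "?f h \<noteq> 0" if "\<bar>h\<bar> < \<epsilon>" for h
    using pos[OF that] by (auto simp: complex_nonpos_Reals_iff complex_eq_iff)
  have "smooth_on {-\<epsilon><..<\<epsilon>} (\<lambda>h. Ln (?f h))"
    unfolding smooth_on_def
    using smooth npos(1)
    by (intro allI ck_on_Ln ck_on_add ck_on_const ck_on_mult ck_on_of_real) (auto simp: smooth_on_def)
  from hadamard_quotient[OF this] obtain d where d: "smooth_on {-\<epsilon><..<\<epsilon>} d"
    "\<And>h. \<bar>h\<bar> < \<epsilon> \<Longrightarrow> Ln (?f h) = h *\<^sub>R d h"
    by auto
  have exp_d: "exp (of_real h * d h) = ?f h" if "\<bar>h\<bar> < \<epsilon>" for h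
    using d(2)[OF that] exp_Ln[OF npos(2)[OF that]] by (simp add: scaleR_conv_of_real)
  have d_real: "d h \<in> \<real>" if h: "\<bar>h\<bar> < \<epsilon>" "h \<noteq> 0" for h
  proof -
    have "?f h \<in> \<real>" using real[OF h(1)] by (intro Reals_add Reals_mult) auto
    then obtain r where r: "?f h = of_real r" by (rule Reals_cases)
    then have "r > 0" using pos[OF h(1)] by simp
    then have "Ln (?f h) = of_real (ln r)" by (simp add: r Ln_of_real)
    then have "d h = of_real (ln r / h)"
      using d(2)[OF h(1)] h(2) by (simp add: scaleR_conv_of_real field_simps)
    then show ?thesis by simp
  qed
  obtain l' where l': "l = of_real l'" using l by (auto elim: Reals_cases)
  have ev: "eventually (\<lambda>h. norm (d h - l) \<le> 2 * norm (\<mu> h - m h)) (at 0)"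
  proof -
    have "((\<lambda>h. exp (h * l')) \<longlongrightarrow> exp (0 * l')) (at 0)" by (intro tendsto_intros)
    then have "eventually (\<lambda>h. exp (h * l') > 1 / 2) (at 0)"
      by (rule order_tendstoD) simp
    moreover have "eventually (\<lambda>h. h \<in> {-\<epsilon><..<\<epsilon>}) (at 0)"
      using \<epsilon> by (intro eventually_at_in_open') auto
    moreover have "eventually (\<lambda>h::real. h \<noteq> 0) (at 0)" by (simp add: eventually_at_filter)
    ultimately show ?thesis
    proof eventually_elim
      case (elim h)
      then have h: "\<bar>h\<bar> < \<epsilon>" "h \<noteq> 0" by auto
      obtain d' where d': "d h = of_real d'" using d_real[OF h] by (auto elim: Reals_cases)
      have e1: "complex_of_real (exp (h * d')) = ?f h" using exp_d[OF h(1)] by (simp add: d' flip: exp_of_real)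
      have e2: "complex_of_real (exp (h * l')) = 1 + of_real h * m h" using m[of h] by (simp add: l' flip: exp_of_real)
      have "exp (h * d') \<ge> 1 / 2" using pos[OF h(1)] unfolding e1[symmetric] by simp
      then have "\<bar>h * d' - h * l'\<bar> \<le> 2 * \<bar>exp (h * d') - exp (h * l')\<bar>"
        using elim by (intro abs_diff_le_exp_diff) auto
      also have "\<bar>exp (h * d') - exp (h * l')\<bar> = norm (complex_of_real (exp (h * d')) - complex_of_real (exp (h * l')))"
        by (simp only: norm_of_real flip: of_real_diff)
      also have "\<dots> = norm (of_real h * (\<mu> h - m h))"
        unfolding e1 e2 by (simp add: algebra_simps)
      also have "\<dots> = \<bar>h\<bar> * norm (\<mu> h - m h)" by (simp add: norm_mult)
      also have "\<bar>h * d' - h * l'\<bar> = \<bar>h\<bar> * \<bar>d' - l'\<bar>"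
        by (simp only: abs_mult flip: right_diff_distrib)
      finally have "\<bar>h\<bar> * \<bar>d' - l'\<bar> \<le> \<bar>h\<bar> * (2 * norm (\<mu> h - m h))"
        by (simp only: mult.left_commute)
      then have "\<bar>d' - l'\<bar> \<le> 2 * norm (\<mu> h - m h)" using h(2) by simp
      then show ?case by (simp only: d' l' norm_of_real flip: of_real_diff)
    qed
  qed
  then have "(\<lambda>h. d h - l) \<in> O[at 0](\<lambda>h. \<mu> h - m h)" by (rule landau_o.bigI[rotated]) simp
  then have ord: "(\<lambda>h. d h - l) \<in> O[at 0](\<lambda>h. of_real h ^ p)" using order by (rule landau_o.big_trans)
  have "(d \<longlongrightarrow> l) (at 0)"
    using bigo_power_imp_tendsto_0[OF ord p] by (rule LIM_zero_cancel)
  moreover have "isCont d 0"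
    using d(1) \<epsilon> ck_on_imp_continuous[of 0 "{-\<epsilon><..<\<epsilon>}" d]
    by (simp add: smooth_on_def continuous_on_eq_continuous_at del: ck_on.simps)
  ultimately have d0: "d 0 = l" unfolding isCont_def by (metis LIM_unique)
  have "d h \<in> \<real>" if "\<bar>h\<bar> < \<epsilon>" for h
    using d_real[OF that] d0 l by (cases "h = 0") auto
  then show ?thesis using d(1) exp_d d0 ord by (intro that[of d])
qed

lemma tendsto_exp_quotient: "((\<lambda>h. (exp (of_real h * c) - 1) / of_real h) \<longlongrightarrow> c) (at (0::real))"
  for c :: complex
proof -
  have "((\<lambda>h. exp (of_real h * c)) has_vector_derivative c) (at (0::real))"
    by (rule has_vector_derivative_real_field[where f="\<lambda>z. exp (z * c)"])
       (auto intro!: derivative_eq_intros)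
  then have "((\<lambda>h. (exp (of_real h * c) - exp (of_real 0 * c)) /\<^sub>R (h - 0)) \<longlongrightarrow> c) (at (0::real))"
    by (simp only: has_vector_derivative_iff_slope)
  then show ?thesis
    by (simp add: scaleR_conv_of_real divide_inverse mult.commute)
qed

text \<open>The passage from \<open>T\<close> to \<open>B = (T - 1) / h\<close>, which pulls the eigenvalues \<open>exp (h l\<^sub>i)\<close> apart. The order
  condition forces \<open>T 0 = 1\<close>, so that the quotient is smooth; after division by \<open>h\<close> it becomes the
  order condition for \<open>B\<close>, which in turn determines \<open>B 0\<close>.\<close>

lemma smooth_quotient:
  fixes T :: "real \<Rightarrow> complex ^ 'n ^ 'n"
  assumes smooth: "\<And>a b. smooth_on {-1<..<1} (\<lambda>h. T h $ a $ b)" and p: "p \<ge> 1"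
    and order: "\<And>a b. (\<lambda>h. T h $ a $ b - (if a = b then exp (of_real h * l a) else 0))
                  \<in> O[at 0](\<lambda>h. of_real h ^ (p + 1))"
  obtains B where "\<And>a b. smooth_on {-1<..<1} (\<lambda>h. (B h :: complex ^ 'n ^ 'n) $ a $ b)"
    "B 0 = diag_mat l" "\<And>h. \<bar>h\<bar> < 1 \<Longrightarrow> T h = mat 1 + h *\<^sub>R B h"
    "\<And>a b. (\<lambda>h. B h $ a $ b - (if a = b then (exp (of_real h * l a) - 1) / of_real h else 0))
        \<in> O[at 0](\<lambda>h. of_real h ^ p)"
proof -
  have T0: "T 0 $ a $ b = mat 1 $ a $ b" for a b
  proof -
    have "((\<lambda>h. T h $ a $ b - (if a = b then exp (of_real h * l a) else 0)) \<longlongrightarrow> 0) (at 0)"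
      by (rule bigo_power_imp_tendsto_0[OF order]) simp
    moreover have "((\<lambda>h. T h $ a $ b - (if a = b then exp (of_real h * l a) else 0)) \<longlongrightarrow>
        T 0 $ a $ b - (if a = b then exp (of_real 0 * l a) else 0)) (at 0)"
      using smooth_on_continuous_at_0[OF smooth[of a b]]
      by (intro tendsto_diff) (auto intro!: tendsto_eq_intros)
    ultimately have "0 = T 0 $ a $ b - (if a = b then exp (of_real 0 * l a) else 0)"
      by (rule LIM_unique)
    then show ?thesis by (simp add: mat_def split: if_splits)
  qed
  have "\<exists>g. smooth_on {-1<..<1} g \<and> (\<forall>h. \<bar>h\<bar> < 1 \<longrightarrow> T h $ a $ b - T 0 $ a $ b = h *\<^sub>R g h)" for a b
  proof -
    have "smooth_on {-1<..<1} (\<lambda>h. T h $ a $ b - T 0 $ a $ b)"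
      using smooth[of a b] by (simp add: smooth_on_def ck_on_diff ck_on_const)
    then show ?thesis by (rule hadamard_quotient) auto
  qed
  then obtain g where g: "\<And>a b. smooth_on {-1<..<1} (g a b)"
    "\<And>a b h. \<bar>h\<bar> < 1 \<Longrightarrow> T h $ a $ b - T 0 $ a $ b = h *\<^sub>R g a b h"
    by metis
  define B :: "real \<Rightarrow> complex ^ 'n ^ 'n" where "B h = (\<chi> a b. g a b h)" for h
  have TB: "T h = mat 1 + h *\<^sub>R B h" if "\<bar>h\<bar> < 1" for h
    using g(2)[OF that] by (simp add: vec_eq_iff B_def T0 diff_eq_eq add.commute)
  let ?m = "\<lambda>a b h. if a = b then (exp (of_real h * l a) - 1) / of_real h else 0"
  have ord: "(\<lambda>h. B h $ a $ b - ?m a b h) \<in> O[at 0](\<lambda>h. of_real h ^ p)" for a b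
  proof -
    obtain c where c: "c > 0" "eventually (\<lambda>h. norm (T h $ a $ b - (if a = b then exp (of_real h * l a) else 0))
        \<le> c * norm (of_real h ^ (p + 1) :: complex)) (at 0)"
      using order[of a b] by (elim landau_o.bigE)
    have "eventually (\<lambda>h. h \<in> {-1<..<1::real}) (at 0)"
      by (intro eventually_at_in_open') auto
    moreover have "eventually (\<lambda>h::real. h \<noteq> 0) (at 0)" by (simp add: eventually_at_filter)
    ultimately have "eventually (\<lambda>h. norm (B h $ a $ b - ?m a b h) \<le> c * norm (of_real h ^ p :: complex)) (at 0)"
      using c(2)
    proof eventually_elim
      case (elim h)
      then have h: "\<bar>h\<bar> < 1" "h \<noteq> 0" by auto
      have "T h $ a $ b - (if a = b then exp (of_real h * l a) else 0) = of_real h * (B h $ a $ b - ?m a b h)"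
        unfolding TB[OF h(1)] vector_add_component scaleR_matrix_nth
        using h(2) by (simp add: mat_def field_simps)
      with elim(3) have "\<bar>h\<bar> * norm (B h $ a $ b - ?m a b h) \<le> \<bar>h\<bar> * (c * \<bar>h\<bar> ^ p)"
        by (simp add: norm_mult norm_power mult.left_commute)
      then show ?case using h(2) by (simp add: norm_power)
    qed
    then show ?thesis by (rule landau_o.bigI[OF c(1)])
  qed
  have "B 0 $ a $ b = diag_mat l $ a $ b" for a b
  proof -
    have "((\<lambda>h. B h $ a $ b - ?m a b h) \<longlongrightarrow> 0) (at 0)"
      by (rule bigo_power_imp_tendsto_0[OF ord p])
    moreover have "(?m a b \<longlongrightarrow> diag_mat l $ a $ b) (at 0)"
      using tendsto_exp_quotient by (cases "a = b") (simp_all add: diag_mat_nth)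
    ultimately have "((\<lambda>h. B h $ a $ b - ?m a b h + ?m a b h) \<longlongrightarrow> 0 + diag_mat l $ a $ b) (at 0)"
      by (rule tendsto_add)
    then have "((\<lambda>h. B h $ a $ b) \<longlongrightarrow> diag_mat l $ a $ b) (at 0)" by simp
    moreover have "((\<lambda>h. B h $ a $ b) \<longlongrightarrow> B 0 $ a $ b) (at 0)"
      using smooth_on_continuous_at_0[OF g(1)[of a b]] by (simp add: B_def)
    ultimately show ?thesis by (metis LIM_unique)
  qed
  then have "B 0 = diag_mat l" by (simp add: vec_eq_iff)
  with g(1) TB ord show ?thesis by (intro that[of B]) (simp_all add: B_def)
qed

section \<open>Real logarithms of perturbed exponentials\<close>

theorem theorem3p4:
  fixes H :: "complex ^ 'n ^ 'n"
    and S :: "real \<Rightarrow> complex ^ 'n ^ 'n"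
    and p :: nat
  assumes "smooth S"
    and "\<And>h. eigenvalues (S h) = cnj ` eigenvalues (S h)"
    and "p \<ge> 1"
    and "(\<lambda>h. norm (S h - matrix_exp (h *\<^sub>R H))) \<in> O[at 0](\<lambda>h. h ^ (p + 1))"
    and "\<And>c. c \<in> eigenvalues H \<Longrightarrow> c \<in> \<real> \<and> simple_eigenvalue H c"
  shows "\<exists>(D :: real \<Rightarrow> complex ^ 'n ^ 'n) (P :: real \<Rightarrow> complex ^ 'n ^ 'n).
           smooth D \<and> (\<forall>h. real_diagonal (D h)) \<and>
           smooth P \<and> (\<forall>h. invertible (P h)) \<and>
           (\<lambda>h. norm (P h - P 0)) \<in> O[at 0](\<lambda>h. h ^ p) \<and>
           (\<lambda>h. norm (D h - D 0)) \<in> O[at 0](\<lambda>h. h ^ p) \<and>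
           (\<exists>\<epsilon>>0. \<forall>h. \<bar>h\<bar> < \<epsilon> \<longrightarrow>
              S h = P h ** matrix_exp (h *\<^sub>R D h) ** matrix_inv (P h))"
proof -
  obtain V :: "complex ^ 'n ^ 'n" and l where V: "invertible V" and l: "inj l" "range l = eigenvalues H"
    and HV: "H ** V = V ** diag_mat l"
    using diagonalization_of_distinct[OF card_simple_eigenvalues] assms(5) by blast
  have l_real: "l i \<in> \<real>" for i using assms(5) l(2) by blast
  define V' where "V' = matrix_inv V"
  have VV': "V ** V' = mat 1" and V'V: "V' ** V = mat 1"
    using V by (simp_all add: V'_def invertible_matrix_inv)
  have H: "H = V ** diag_mat l ** V'"
    by (metis HV VV' matrix_mul_assoc matrix_mul_rid)
  have exp_hH: "matrix_exp (h *\<^sub>R H) = V ** diag_mat (\<lambda>i. exp (of_real h * l i)) ** V'" for h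
  proof -
    have "h *\<^sub>R H = V ** diag_mat (\<lambda>i. of_real h * l i) ** V'"
      unfolding H by (simp add: vec_eq_iff matrix_matrix_mult_def[of _ V'] matrix_mult_diag_nth
          scaleR_matrix_nth sum_distrib_left ac_simps del: vector_scaleR_component)
    then show ?thesis using matrix_exp_diagonalizable[OF V'V] by simp
  qed

  define T where "T h = V' ** S h ** V" for h
  have entry: "(V' ** X ** V) $ a $ b = (\<Sum>d\<in>UNIV. (\<Sum>c\<in>UNIV. V' $ a $ c * X $ c $ d) * V $ d $ b)" for X a b
    by (simp add: matrix_matrix_mult_def)
  have ckS: "ck_on n UNIV (\<lambda>h. S h $ a $ b)" for n a b
  proof -
    have "ck_on n UNIV S" using assms(1) by (simp add: smooth_on_def flip: smooth_on_UNIV_iff)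
    from ck_on_bounded_linear[OF bounded_linear_vec_nth ck_on_bounded_linear[OF bounded_linear_vec_nth this]]
    show ?thesis .
  qed
  have smoothT: "smooth_on {-1<..<1} (\<lambda>h. T h $ a $ b)" for a b
    unfolding smooth_on_def T_def entry
    by (intro allI ck_on_sum ck_on_mult ck_on_const ck_on_subset[OF ckS subset_UNIV])
  \<comment> \<open>Conjugation by \<open>V\<close> turns the consistency condition into one on the entries of \<open>T\<close>.\<close>
  have orderT: "(\<lambda>h. T h $ a $ b - (if a = b then exp (of_real h * l a) else 0))
                  \<in> O[at 0](\<lambda>h. of_real h ^ (p + 1))" for a b
  proof -
    let ?R = "\<lambda>h. S h - matrix_exp (h *\<^sub>R H)"
    obtain c where c: "c > 0" "eventually (\<lambda>h. norm (norm (?R h)) \<le> c * norm (h ^ (p + 1))) (at 0)"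
      using assms(4) by (elim landau_o.bigE)
    have R: "(\<lambda>h. ?R h $ a $ b) \<in> O[at 0](\<lambda>h. of_real h ^ (p + 1))" for a b
    proof (rule landau_o.bigI[OF c(1)])
      show "eventually (\<lambda>h. norm (?R h $ a $ b) \<le> c * norm (of_real h ^ (p + 1) :: complex)) (at 0)"
        using c(2)
      proof eventually_elim
        case (elim h)
        have "norm (?R h $ a $ b) \<le> norm (?R h $ a)" by (rule Finite_Cartesian_Product.norm_nth_le)
        also have "\<dots> \<le> norm (?R h)" by (rule Finite_Cartesian_Product.norm_nth_le)
        also have "\<dots> \<le> c * norm (of_real h ^ (p + 1) :: complex)"
          using elim by (simp add: norm_power norm_mult abs_mult power_abs)
        finally show ?case .
      qed
    qed
    have "T h $ a $ b - (if a = b then exp (of_real h * l a) else 0) = (V' ** ?R h ** V) $ a $ b" for h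
    proof -
      have "V' ** ?R h ** V = T h - V' ** matrix_exp (h *\<^sub>R H) ** V"
        by (simp only: T_def matrix_mult_diff_mult)
      also have "V' ** matrix_exp (h *\<^sub>R H) ** V = (V' ** V) ** diag_mat (\<lambda>i. exp (of_real h * l i)) ** (V' ** V)"
        by (simp only: exp_hH matrix_mul_assoc)
      finally show ?thesis by (simp add: V'V diag_mat_nth)
    qed
    then show ?thesis
      unfolding entry
      by (simp only:) (intro big_sum_in_bigo bigo_mult_tendsto[OF _ tendsto_const] bigo_cmult R)
  qed
  obtain B where smoothB: "\<And>a b. smooth_on {-1<..<1} (\<lambda>h. (B h :: complex ^ 'n ^ 'n) $ a $ b)"
    and B0: "B 0 = diag_mat l" and TB: "\<And>h. \<bar>h\<bar> < 1 \<Longrightarrow> T h = mat 1 + h *\<^sub>R B h"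
    and orderB: "\<And>a b. (\<lambda>h. B h $ a $ b - (if a = b then (exp (of_real h * l a) - 1) / of_real h else 0))
        \<in> O[at 0](\<lambda>h. of_real h ^ p)"
    by (rule smooth_quotient[OF smoothT assms(3) orderT]) (rule that)
  obtain \<epsilon>1 \<mu> W where \<epsilon>1: "0 < \<epsilon>1" "\<epsilon>1 \<le> 1" and smooth\<mu>: "\<And>i. smooth_on {-\<epsilon>1<..<\<epsilon>1} (\<mu> i)"
    and \<mu>0: "\<And>i. \<mu> i 0 = l i"
    and smoothW: "\<And>i j. smooth_on {-\<epsilon>1<..<\<epsilon>1} (\<lambda>h. (W h :: complex ^ 'n ^ 'n) $ i $ j)"
    and W0: "W 0 = mat 1" and invW: "\<And>h. \<bar>h\<bar> < \<epsilon>1 \<Longrightarrow> invertible (W h)"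
    and Wii: "\<And>h i. \<bar>h\<bar> < \<epsilon>1 \<Longrightarrow> W h $ i $ i = 1"
    and BW: "\<And>h. \<bar>h\<bar> < \<epsilon>1 \<Longrightarrow> B h ** W h = W h ** diag_mat (\<lambda>i. \<mu> i h)"
    by (rule smooth_diagonalization[OF zero_less_one smoothB B0 l(1)]) (rule that)
  have lim\<mu>: "(\<mu> i \<longlongrightarrow> l i) (at 0)" for i
    using smooth_on_continuous_at_0[OF smooth\<mu>[of i] \<epsilon>1(1)] by (simp add: \<mu>0)
  have limW: "((\<lambda>h. W h $ a $ i) \<longlongrightarrow> mat 1 $ a $ i) (at 0)" for a i
    using smooth_on_continuous_at_0[OF smoothW[of a i] \<epsilon>1(1)] by (simp add: W0)
  have limB: "((\<lambda>h. B h $ a $ a) \<longlongrightarrow> l a) (at 0)" for a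
    using smooth_on_continuous_at_0[OF smoothB[of a a]] by (simp add: B0 diag_mat_nth)
  have ev1: "eventually (\<lambda>h. h \<in> {-\<epsilon>1<..<\<epsilon>1}) (at 0)"
    using \<epsilon>1 by (intro eventually_at_in_open') auto
  have evW: "eventually (\<lambda>h. B h ** W h = W h ** diag_mat (\<lambda>i. \<mu> i h) \<and> (\<forall>i. W h $ i $ i = 1)) (at 0)"
    using ev1 by eventually_elim (auto simp: BW Wii)
  note orders = diagonalization_order[OF orderB limB l(1) lim\<mu> limW evW]

  \<comment> \<open>The first condition will make the \<open>\<mu> i h\<close> real, the second keeps \<open>1 + h \<mu> i h\<close> off the branch cut
    of the logarithm.\<close>
  have ev\<mu>: "eventually (\<lambda>h. (\<forall>i j. i \<noteq> j \<longrightarrow> cnj (\<mu> i h) \<noteq> \<mu> j h) \<and>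
      (\<forall>i. Re (1 + of_real h * \<mu> i h) \<ge> 1 / 2)) (nhds 0)"
  proof -
    have "eventually (\<lambda>h. (\<forall>i j. i \<noteq> j \<longrightarrow> cnj (\<mu> i h) \<noteq> \<mu> j h) \<and>
      (\<forall>i. Re (1 + of_real h * \<mu> i h) \<ge> 1 / 2)) (at 0)"
    proof (intro eventually_conj eventually_all_finite)
      fix i j
      show "eventually (\<lambda>h. i \<noteq> j \<longrightarrow> cnj (\<mu> i h) \<noteq> \<mu> j h) (at 0)"
      proof (cases "i = j")
        case False
        have "((\<lambda>h. cnj (\<mu> i h) - \<mu> j h) \<longlongrightarrow> cnj (l i) - l j) (at 0)"
          by (intro tendsto_intros lim\<mu>)
        moreover have "cnj (l i) - l j \<noteq> 0"
          using False l(1) l_real[of i] by (auto simp: inj_eq Reals_cnj_iff)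
        ultimately have "eventually (\<lambda>h. cnj (\<mu> i h) - \<mu> j h \<noteq> 0) (at 0)"
          by (rule tendsto_imp_eventually_ne)
        then show ?thesis by simp
      qed simp
    next
      fix i
      have "((\<lambda>h. Re (1 + of_real h * \<mu> i h)) \<longlongrightarrow> Re (1 + of_real 0 * l i)) (at 0)"
        by (intro tendsto_intros lim\<mu>)
      then have "eventually (\<lambda>h. Re (1 + of_real h * \<mu> i h) > 1 / 2) (at 0)"
        by (rule order_tendstoD) simp
      then show "eventually (\<lambda>h. Re (1 + of_real h * \<mu> i h) \<ge> 1 / 2) (at 0)"
        by (rule eventually_mono) simp
    qed
    moreover have "cnj (\<mu> i 0) \<noteq> \<mu> j 0" if "i \<noteq> j" for i j
      using that l(1) l_real[of i] by (auto simp: \<mu>0 inj_eq Reals_cnj_iff)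
    ultimately show ?thesis unfolding eventually_nhds_conv_at by auto
  qed
  then obtain \<epsilon>2 where \<epsilon>2: "\<epsilon>2 > 0" "\<And>h i j. \<bar>h\<bar> < \<epsilon>2 \<Longrightarrow> i \<noteq> j \<Longrightarrow> cnj (\<mu> i h) \<noteq> \<mu> j h"
    "\<And>h i. \<bar>h\<bar> < \<epsilon>2 \<Longrightarrow> Re (1 + of_real h * \<mu> i h) \<ge> 1 / 2"
    unfolding eventually_nhds_metric dist_real_def by (metis diff_zero)
  define \<epsilon> where "\<epsilon> = min \<epsilon>1 \<epsilon>2"
  have \<epsilon>: "0 < \<epsilon>" "\<epsilon> \<le> \<epsilon>1" "\<epsilon> \<le> \<epsilon>2" "\<epsilon> \<le> 1" using \<epsilon>1 \<epsilon>2(1) by (auto simp: \<epsilon>_def)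
  have sub: "{-\<epsilon><..<\<epsilon>} \<subseteq> {-\<epsilon>1<..<\<epsilon>1}" using \<epsilon> by auto

  have Sdiag: "S h = (V ** W h) ** diag_mat (\<lambda>i. 1 + of_real h * \<mu> i h) ** matrix_inv (V ** W h)"
    and VWinv: "invertible (V ** W h)" if h: "\<bar>h\<bar> < \<epsilon>" for h
  proof -
    show inv: "invertible (V ** W h)"
      using h \<epsilon> by (intro invertible_mult V invW) auto
    have "T h ** W h = W h + h *\<^sub>R (B h ** W h)"
      using TB[of h] h \<epsilon> by (simp add: matrix_add_scaleR_mult)
    also have "\<dots> = W h ** diag_mat (\<lambda>i. 1 + of_real h * \<mu> i h)"
      using BW[of h] h \<epsilon>
      by (simp add: vec_eq_iff matrix_mult_diag_nth scaleR_matrix_nth algebra_simps del: vector_scaleR_component)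
    finally have TW: "T h ** W h = W h ** diag_mat (\<lambda>i. 1 + of_real h * \<mu> i h)" .
    have "S h ** (V ** W h) = V ** (T h ** W h)"
    proof -
      have "V ** (T h ** W h) = (V ** V') ** S h ** V ** W h"
        by (simp only: T_def matrix_mul_assoc)
      then show ?thesis by (simp add: VV' matrix_mul_assoc)
    qed
    then have "S h ** (V ** W h) = (V ** W h) ** diag_mat (\<lambda>i. 1 + of_real h * \<mu> i h)"
      by (simp only: TW matrix_mul_assoc)
    then have "S h ** ((V ** W h) ** matrix_inv (V ** W h)) =
        (V ** W h) ** diag_mat (\<lambda>i. 1 + of_real h * \<mu> i h) ** matrix_inv (V ** W h)"
      by (metis matrix_mul_assoc)
    then show "S h = (V ** W h) ** diag_mat (\<lambda>i. 1 + of_real h * \<mu> i h) ** matrix_inv (V ** W h)"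
      using invertible_matrix_inv[OF inv] by simp
  qed
  \<comment> \<open>At \<open>h = 0\<close> the spectrum of \<open>S h\<close> carries no information on the \<open>\<mu> i h\<close>, but \<open>\<mu> i 0 = l i\<close>.\<close>
  have \<mu>_real: "\<mu> i h \<in> \<real>" if h: "\<bar>h\<bar> < \<epsilon>" for i h
  proof (cases "h = 0")
    case True
    then show ?thesis using l_real by (simp add: \<mu>0)
  next
    case False
    have "eigenvalues (S h) = range (\<lambda>i. 1 + of_real h * \<mu> i h)"
      unfolding Sdiag[OF h]
      using VWinv[OF h] by (intro eigenvalues_diagonalizable) (simp add: invertible_matrix_inv)
    then have "cnj (1 + of_real h * \<mu> i h) \<in> range (\<lambda>i. 1 + of_real h * \<mu> i h)"
      using assms(2)[of h] by blast
    then obtain j where "cnj (1 + of_real h * \<mu> i h) = 1 + of_real h * \<mu> j h" by blast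
    then have "cnj (\<mu> i h) = \<mu> j h" using False by simp
    then have "cnj (\<mu> i h) = \<mu> i h" using \<epsilon>2(2)[of h i j] h \<epsilon>(3) by fastforce
    then show ?thesis by (simp add: Reals_cnj_iff)
  qed
  have "\<exists>d. smooth_on {-\<epsilon><..<\<epsilon>} d \<and> (\<forall>h. \<bar>h\<bar> < \<epsilon> \<longrightarrow> d h \<in> \<real>) \<and>
     (\<forall>h. \<bar>h\<bar> < \<epsilon> \<longrightarrow> exp (of_real h * d h) = 1 + of_real h * \<mu> i h) \<and> d 0 = l i \<and>
     (\<lambda>h. d h - l i) \<in> O[at 0](\<lambda>h. of_real h ^ p)" for i
  proof -
    let ?m = "\<lambda>h. (exp (of_real h * l i) - 1) / of_real h"
    have m: "exp (of_real h * l i) = 1 + of_real h * ?m h" for h by simp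
    have pos: "Re (1 + of_real h * \<mu> i h) \<ge> 1 / 2" if "\<bar>h\<bar> < \<epsilon>" for h
      using \<epsilon>2(3)[of h i] that \<epsilon>(3) by simp
    show ?thesis
      by (rule smooth_logarithm[OF \<epsilon>(1) smooth_on_subset[OF smooth\<mu> sub] \<mu>_real pos l_real m orders(2) assms(3)])
         blast+
  qed
  then obtain d where smoothd: "\<And>i. smooth_on {-\<epsilon><..<\<epsilon>} (d i)"
    and d_real: "\<And>i h. \<bar>h\<bar> < \<epsilon> \<Longrightarrow> d i h \<in> \<real>"
    and exp_d: "\<And>i h. \<bar>h\<bar> < \<epsilon> \<Longrightarrow> exp (of_real h * d i h) = 1 + of_real h * \<mu> i h"
    and d0: "\<And>i. d i 0 = l i" and orderd: "\<And>i. (\<lambda>h. d i h - l i) \<in> O[at 0](\<lambda>h. of_real h ^ p)"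
    by metis

  \<comment> \<open>From here on the local families are made global by composing them with \<open>\<phi>\<close>.\<close>
  obtain \<phi> :: "real \<Rightarrow> real" where \<phi>: "smooth_on UNIV \<phi>" "\<And>t. \<bar>\<phi> t\<bar> < \<epsilon>" "\<And>t. \<bar>t\<bar> < \<epsilon> / 2 \<Longrightarrow> \<phi> t = t"
    using smooth_retraction[OF \<epsilon>(1)] by blast
  have \<phi>0: "\<phi> 0 = 0" using \<phi>(3)[of 0] \<epsilon>(1) by simp
  have ck\<phi>: "ck_on n UNIV (\<lambda>h. f (\<phi> h))" if "smooth_on {-\<epsilon><..<\<epsilon>} f" for n and f :: "real \<Rightarrow> complex"
  proof (rule ck_on_compose)
    show "ck_on n {-\<epsilon><..<\<epsilon>} f" "ck_on n UNIV \<phi>" using that \<phi>(1) by (simp_all add: smooth_on_def)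
    show "\<phi> t \<in> {-\<epsilon><..<\<epsilon>}" for t using \<phi>(2)[of t] by auto
  qed
  have ev\<phi>: "eventually (\<lambda>h. \<phi> h = h) (at 0)"
  proof -
    have "eventually (\<lambda>h. h \<in> {-(\<epsilon> / 2)<..<\<epsilon> / 2}) (at 0)"
      using \<epsilon>(1) by (intro eventually_at_in_open') auto
    then show ?thesis by eventually_elim (auto intro: \<phi>(3))
  qed
  define D where "D h = diag_mat (\<lambda>i. d i (\<phi> h))" for h
  define P where "P h = V ** W (\<phi> h)" for h
  have "smooth D"
    unfolding smooth_on_UNIV_iff[symmetric] smooth_on_def
  proof (intro allI ck_on_vec)
    fix n i j
    show "ck_on n UNIV (\<lambda>h. D h $ i $ j)"
      using ck\<phi>[OF smoothd] by (cases "i = j") (simp_all add: D_def diag_mat_nth ck_on_const)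
  qed
  moreover have "real_diagonal (D h)" for h
    using d_real \<phi>(2) by (auto simp: real_diagonal_def D_def diag_mat_nth)
  moreover have "smooth P"
    unfolding smooth_on_UNIV_iff[symmetric] smooth_on_def
  proof (intro allI ck_on_vec)
    fix n i j
    show "ck_on n UNIV (\<lambda>h. P h $ i $ j)"
      unfolding P_def matrix_matrix_mult_def vec_lambda_beta
      by (intro ck_on_sum ck_on_mult ck_on_const ck\<phi> smooth_on_subset[OF smoothW sub])
  qed
  moreover have "invertible (P h)" for h
    unfolding P_def by (rule VWinv[OF \<phi>(2)])
  moreover have "(\<lambda>h. norm (P h - P 0)) \<in> O[at 0](\<lambda>h. h ^ p)"
  proof (rule bigo_matrix_norm)
    fix a b
    have "(\<lambda>h. W h $ c $ b - mat 1 $ c $ b) \<in> O[at 0](\<lambda>h. of_real h ^ p)" for c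
    proof (cases "c = b")
      case True
      have ev: "eventually (\<lambda>h. W h $ c $ b - mat 1 $ c $ b = 0) (at 0)"
        using ev1 by eventually_elim (auto simp: True Wii mat_def)
      show ?thesis unfolding landau_o.big.in_cong[OF ev] by simp
    next
      case False
      then show ?thesis using orders(1)[of c b] by (simp add: mat_def)
    qed
    then have "(\<lambda>h. \<Sum>c\<in>UNIV. V $ a $ c * (W h $ c $ b - mat 1 $ c $ b)) \<in> O[at 0](\<lambda>h. of_real h ^ p)"
      by (intro big_sum_in_bigo) simp
    moreover have ev: "eventually (\<lambda>h. (P h - P 0) $ a $ b = (\<Sum>c\<in>UNIV. V $ a $ c * (W h $ c $ b - mat 1 $ c $ b))) (at 0)"
      using ev\<phi>
      by eventually_elim
         (simp add: P_def \<phi>0 W0 matrix_matrix_mult_def right_diff_distrib sum_subtractf del: matrix_mul_rid)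
    ultimately show "(\<lambda>h. (P h - P 0) $ a $ b) \<in> O[at 0](\<lambda>h. of_real h ^ p)"
      by (simp only: landau_o.big.in_cong[OF ev])
  qed
  moreover have "(\<lambda>h. norm (D h - D 0)) \<in> O[at 0](\<lambda>h. h ^ p)"
  proof (rule bigo_matrix_norm)
    fix a b
    have ev: "eventually (\<lambda>h. (D h - D 0) $ a $ b = (if a = b then d a h - l a else 0)) (at 0)"
      using ev\<phi> by eventually_elim (simp add: D_def \<phi>0 d0 diag_mat_nth)
    show "(\<lambda>h. (D h - D 0) $ a $ b) \<in> O[at 0](\<lambda>h. of_real h ^ p)"
      unfolding landau_o.big.in_cong[OF ev] using orderd by (cases "a = b") simp_all
  qed
  moreover have "S h = P h ** matrix_exp (h *\<^sub>R D h) ** matrix_inv (P h)" if h: "\<bar>h\<bar> < \<epsilon> / 2" for h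
  proof -
    have h': "\<bar>h\<bar> < \<epsilon>" using h \<epsilon>(1) by linarith
    have "h *\<^sub>R D h = mat 1 ** diag_mat (\<lambda>i. of_real h * d i h) ** mat 1"
      by (simp add: D_def \<phi>(3)[OF h] vec_eq_iff diag_mat_nth scaleR_matrix_nth del: vector_scaleR_component)
    then have "matrix_exp (h *\<^sub>R D h) = diag_mat (\<lambda>i. 1 + of_real h * \<mu> i h)"
      using matrix_exp_diagonalizable[of "mat 1 :: complex ^ 'n ^ 'n" "mat 1"] by (simp add: exp_d[OF h'])
    then show ?thesis
      using Sdiag[OF h'] by (simp add: P_def \<phi>(3)[OF h])
  qed
  ultimately show ?thesis
    using \<epsilon>(1) half_gt_zero by blast
qed

end
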